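(* For every real $\rho\ge 0$ with $\rho\neq\rho_s$ and $\zeta'(1/2+i\rho)\neq0$, $$\frac{4\,|\zeta(1/2+i\rho)|^2}{f(\rho)^2\,|\zeta'(1/2+i\rho)|^2}=2+\frac{2\left(\sinh(\frac{\pi\rho}{2})\sin(2\beta+\rho_\theta)+\cosh(\frac{\pi\rho}{2})\cos(2\beta+\rho_\theta)\right)}{\sqrt{\cosh(\pi\rho)}}.$$ Consequently, if moreover $\zeta(1/2+i\rho)=0$, then $$\frac{\sinh(\pi\rho/2)\sin(2\beta+\rho_\theta)+\cosh(\pi\rho/2)\cos(2\beta+\rho_\theta)}{\sqrt{\cosh(\pi\rho)}}=-1.$$
   Context: $\zeta$ is the Riemann zeta function and $\zeta'=d\zeta/ds$ its complex derivative. $\beta=\arg\zeta'(1/2+i\rho)$, $\theta=\arg\Gamma(1/2+i\rho)$, and $\rho_\theta=\theta-\rho\ln(2\pi)$ (the formulas do not depend on the choice of arguments modulo $2\pi$). With $\psi=\Gamma'/\Gamma$ the digamma function, $$f(\rho)=\frac{4\cosh(\pi\rho)}{2\ln(2\pi)\cosh(\pi\rho)-2\,\mathrm{Re}(\psi(1/2+i\rho))\cosh(\pi\rho)+\pi},$$ and $\rho_s=6.2898\ldots$ is the unique $\rho>0$ at which the denominator of $f$ vanishes. *)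

theory Defs
  imports "HOL-Complex_Analysis.Complex_Analysis"
begin

text \<open>
  The Riemann zeta function as the analytic continuation of its Dirichlet series to
  the punctured plane. The value at the pole is set to \<open>0\<close>, as the library does for
  other functions with poles; this only serves to make the description unique.
\<close>

definition riemann_zeta :: "complex \<Rightarrow> complex" where
  "riemann_zeta = (THE F. F holomorphic_on - {1} \<and> F 1 = 0 \<and>
     (\<forall>s. Re s > 1 \<longrightarrow> (\<lambda>n. 1 / of_nat (Suc n) powr s) sums F s))"

definition f_denom :: "real \<Rightarrow> real" where
  "f_denom \<rho> = 2 * ln (2 * pi) * cosh (pi * \<rho>)
     - 2 * Re (Digamma (1 / 2 + \<i> * of_real \<rho>)) * cosh (pi * \<rho>) + pi"

definition f_fun :: "real \<Rightarrow> real" where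
  "f_fun \<rho> = 4 * cosh (pi * \<rho>) / f_denom \<rho>"

text \<open>
  Divided by \<open>cosh (pi * \<rho>)\<close>, the denominator is positive at \<open>0\<close> and strictly
  decreases to \<open>-\<infinity>\<close> on the nonnegative half-line, so the description below does
  denote a number, namely \<open>6.2898\<dots>\<close>.
\<close>

definition rho_s :: real where
  "rho_s = (THE \<rho>. \<rho> > 0 \<and> f_denom \<rho> = 0)"

end

theory Submission
  imports Defs
begin

text \<open>
  Differentiating the functional equation \<open>\<zeta>(1 - s) = \<chi>(s) \<zeta>(s)\<close> on the critical line, where
  \<open>1 - s\<close> is the conjugate of \<open>s\<close> and \<open>|\<chi>(s)| = 1\<close>, gives \<open>cnj \<zeta>' + \<chi> \<zeta>' = (2 / f) \<chi> \<zeta>\<close>, because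
  \<open>\<chi>' / \<chi> = - 2 / f\<close> is real there by the reflection formula of the digamma function. Taking
  squared moduli gives \<open>4 |\<zeta>|\<^sup>2 / f\<^sup>2 = 2 |\<zeta>'|\<^sup>2 + 2 Re (\<chi> \<zeta>'\<^sup>2)\<close>.

  The function \<open>\<zeta>\<close> is continued to \<open>Re s > - 1\<close> by the errors of the trapezoidal rule for \<open>x powr (- s)\<close>.
  For real \<open>s\<close> in \<open>(- 1, 0)\<close>, the product \<open>\<Gamma>(s) \<zeta>(s)\<close> is the Mellin transform of
  \<open>1 / (exp x - 1) + 1 / 2 - 1 / x\<close>; expanding this kernel in partial fractions and integrating termwise,
  with all terms nonnegative, yields the functional equation, which then extends analytically.
\<close>

section \<open>Continuation of the zeta function to the half-plane Re s > -1\<close>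

text \<open>Two integrations by parts against the Peano kernel \<open>t * (1 - t) / 2\<close>, which
  vanishes at both ends and has second derivative -1. Banach-valued functions cover both the complex
  powers and the real exponentials below.\<close>

lemma trapezoid_error_has_integral:
  fixes f f' f'' F :: "real \<Rightarrow> 'a::banach"
  assumes "\<And>t. t \<in> {0..1} \<Longrightarrow> (F has_vector_derivative f t) (at t within {0..1})"
    and "\<And>t. t \<in> {0..1} \<Longrightarrow> (f has_vector_derivative f' t) (at t within {0..1})"
    and "\<And>t. t \<in> {0..1} \<Longrightarrow> (f' has_vector_derivative f'' t) (at t within {0..1})"
  shows "((\<lambda>t. (t * (1 - t) / 2) *\<^sub>R f'' t) has_integral
           ((1 / 2) *\<^sub>R (f 0 + f 1) - (F 1 - F 0))) {0..1}"
proof -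
  \<comment> \<open>\<open>G\<close> gathers the boundary terms of both integrations by parts, so
    its derivative is exactly the integrand.\<close>
  define G where "G = (\<lambda>t. (t * (1 - t) / 2) *\<^sub>R f' t - ((1 - 2 * t) / 2) *\<^sub>R f t - F t)"
  have "((\<lambda>t. (t * (1 - t) / 2) *\<^sub>R f'' t) has_integral (G 1 - G 0)) {0..1}"
  proof (rule fundamental_theorem_of_calculus)
    fix t :: real assume t: "t \<in> {0..1}"
    have "((\<lambda>t. t * (1 - t) / 2) has_field_derivative ((1 - 2 * t) / 2)) (at t within {0..1})"
      "((\<lambda>t. (1 - 2 * t) / 2) has_field_derivative (- 1)) (at t within {0..1})"
      by (auto intro!: derivative_eq_intros)
    then have "(G has_vector_derivative
        (((t * (1 - t) / 2) *\<^sub>R f'' t + ((1 - 2 * t) / 2) *\<^sub>R f' t)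
          - (((1 - 2 * t) / 2) *\<^sub>R f' t + (- 1) *\<^sub>R f t) - f t)) (at t within {0..1})"
      unfolding G_def
      by (intro has_vector_derivative_diff has_vector_derivative_scaleR assms t)
    then show "(G has_vector_derivative (t * (1 - t) / 2) *\<^sub>R f'' t) (at t within {0..1})"
      by simp
  qed auto
  also have "G 1 - G 0 = (1 / 2) *\<^sub>R (f 0 + f 1) - (F 1 - F 0)"
    by (simp add: G_def algebra_simps)
  finally show ?thesis .
qed

lemma has_vector_derivative_shifted_powr:
  fixes a :: real and z :: complex
  assumes "a > 0" "t \<ge> 0"
  shows "((\<lambda>t. complex_of_real (a + t) powr z) has_vector_derivative
           z * complex_of_real (a + t) powr (z - 1)) (at t within A)"
proof -
  have "((\<lambda>w. (of_real a + w) powr z) has_field_derivative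
           z * (of_real a + of_real t) powr (z - 1)) (at (complex_of_real t))"
    using assms by (auto intro!: derivative_eq_intros simp: complex_nonpos_Reals_iff)
  from has_vector_derivative_real_field[OF this, of A] show ?thesis
    by (simp add: o_def)
qed

text \<open>The error of the trapezoidal rule for \<open>x powr (- s)\<close> between
  \<open>n + 1\<close> and \<open>n + 2\<close>. The first interval starts at 1, away from the
  singularity at 0.\<close>

definition zeta_trapezoid :: "nat \<Rightarrow> complex \<Rightarrow> complex" where
  "zeta_trapezoid n s =
     (of_nat (Suc n) powr (- s) + of_nat (Suc (Suc n)) powr (- s)) / 2
     - (of_nat (Suc (Suc n)) powr (1 - s) - of_nat (Suc n) powr (1 - s)) / (1 - s)"

lemma zeta_trapezoid_has_integral:
  assumes "s \<noteq> 1"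
  shows "((\<lambda>t. complex_of_real (t * (1 - t) / 2) *
              (s * (s + 1) * complex_of_real (real (Suc n) + t) powr (- s - 2)))
            has_integral zeta_trapezoid n s) {0..1}"
proof -
  let ?p = "\<lambda>z t. complex_of_real (real (Suc n) + t) powr z"
  have "((\<lambda>t. (t * (1 - t) / 2) *\<^sub>R (s * (s + 1) * ?p (- s - 2) t)) has_integral
     ((1 / 2) *\<^sub>R (?p (- s) 0 + ?p (- s) 1) - (?p (1 - s) 1 / (1 - s) - ?p (1 - s) 0 / (1 - s)))) {0..1}"
  proof (rule trapezoid_error_has_integral[where f' = "\<lambda>t. - s * ?p (- s - 1) t"])
    fix t :: real assume "t \<in> {0..1}"
    then have t: "t \<ge> 0" by simp
    note d = has_vector_derivative_shifted_powr[of "real (Suc n)", OF _ t]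
    show "((\<lambda>t. ?p (1 - s) t / (1 - s)) has_vector_derivative ?p (- s) t) (at t within {0..1})"
      using has_vector_derivative_divide[OF d[of "1 - s"], of "1 - s"] assms by simp
    show "(?p (- s) has_vector_derivative - s * ?p (- s - 1) t) (at t within {0..1})"
      by (rule d) simp
    show "((\<lambda>t. - s * ?p (- s - 1) t) has_vector_derivative s * (s + 1) * ?p (- s - 2) t)
            (at t within {0..1})"
      using has_vector_derivative_mult_right[OF d[of "- s - 1"], of "- s"]
      by (simp add: algebra_simps)
  qed
  then show ?thesis
    by (simp add: zeta_trapezoid_def scaleR_conv_of_real diff_divide_distrib add_ac)
qed

text \<open>The integral form involves the second derivative of the power and so gains two powers of
  \<open>n\<close>; this is what makes the errors summable for \<open>Re s > - 1\<close>. For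
  \<open>Re s \<ge> - 2\<close> the power is largest at the left endpoint of the interval.\<close>

lemma norm_zeta_trapezoid_le:
  assumes "s \<noteq> 1" "Re s \<ge> - 2"
  shows "norm (zeta_trapezoid n s) \<le> norm (s * (s + 1)) * real (Suc n) powr (- Re s - 2)"
proof -
  have "norm (zeta_trapezoid n s) \<le>
          (norm (s * (s + 1)) * real (Suc n) powr (- Re s - 2)) * Henstock_Kurzweil_Integration.content (cbox 0 (1::real))"
  proof (rule has_integral_bound)
    show "((\<lambda>t. complex_of_real (t * (1 - t) / 2) *
              (s * (s + 1) * complex_of_real (real (Suc n) + t) powr (- s - 2)))
            has_integral zeta_trapezoid n s) (cbox 0 1)"
      using zeta_trapezoid_has_integral[OF assms(1)] by simp
  next
    fix t :: real assume "t \<in> cbox 0 1"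
    then have t: "0 \<le> t" "t \<le> 1" by auto
    have "norm (complex_of_real (t * (1 - t) / 2)) \<le> 1"
      unfolding norm_of_real using t mult_le_one[of t "1 - t"] by simp
    moreover have "norm (complex_of_real (real (Suc n) + t) powr (- s - 2)) \<le>
                     real (Suc n) powr (- Re s - 2)"
      using t assms by (subst norm_powr_real_powr) (auto intro!: powr_mono2')
    ultimately have "norm (complex_of_real (t * (1 - t) / 2)) *
        (norm (s * (s + 1)) * norm (complex_of_real (real (Suc n) + t) powr (- s - 2)))
        \<le> 1 * (norm (s * (s + 1)) * real (Suc n) powr (- Re s - 2))"
      by (intro mult_mono) auto
    then show "norm (complex_of_real (t * (1 - t) / 2) *
              (s * (s + 1) * complex_of_real (real (Suc n) + t) powr (- s - 2)))
            \<le> norm (s * (s + 1)) * real (Suc n) powr (- Re s - 2)"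
      by (simp add: norm_mult mult_ac)
  qed auto
  then show ?thesis by simp
qed

lemma summable_Suc_powr: "a < - 1 \<Longrightarrow> summable (\<lambda>n. real (Suc n) powr a)"
  using summable_real_powr_iff[of a] summable_Suc_iff[of "\<lambda>n. real n powr a"] by simp

lemma summable_zeta_trapezoid:
  assumes "s \<noteq> 1" "Re s > - 1"
  shows "summable (\<lambda>n. zeta_trapezoid n s)"
proof (rule summable_comparison_test')
  show "summable (\<lambda>n. norm (s * (s + 1)) * real (Suc n) powr (- Re s - 2))"
    using assms by (intro summable_mult summable_Suc_powr) simp
  show "norm (zeta_trapezoid n s) \<le> norm (s * (s + 1)) * real (Suc n) powr (- Re s - 2)"
    if "n \<ge> 0" for n
    using norm_zeta_trapezoid_le[of s n] assms by simp
qed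

text \<open>Euler-Maclaurin form of the Dirichlet series: \<open>1 / (s - 1)\<close> is the integral
  of \<open>x powr (- s)\<close> from 1 to infinity, and \<open>1 / 2\<close> is the half of the
  first term that the trapezoidal rule leaves out.\<close>

definition zeta_right :: "complex \<Rightarrow> complex" where
  "zeta_right s = 1 / (s - 1) + 1 / 2 + (\<Sum>n. zeta_trapezoid n s)"

lemma holomorphic_on_zeta_right: "zeta_right holomorphic_on ({s. Re s > - 1} - {1})"
proof -
  let ?S = "{s. Re s > - 1} - {1::complex}"
  have S: "open ?S" by (intro open_delete open_halfspace_Re_gt)
  have "(\<lambda>s. \<Sum>n. zeta_trapezoid n s) holomorphic_on ?S"
  proof (rule holomorphic_uniform_sequence[OF S])
    show "(\<lambda>s. \<Sum>i<n. zeta_trapezoid i s) holomorphic_on ?S" for n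
      unfolding zeta_trapezoid_def by (intro holomorphic_intros) auto
    fix x assume "x \<in> ?S"
    then obtain d where d: "d > 0" "cball x d \<subseteq> ?S"
      using S open_contains_cball by blast
    \<comment> \<open>The leftmost point of the disc still lies in the region, so the exponent
      \<open>- (Re x - d) - 2\<close>, which is below -1, gives one summable majorant for the whole
      disc.\<close>
    have "Re x - d \<ge> -1 \<and> Re x - d \<noteq> -1"
    proof -
      have "x - of_real d \<in> cball x d" using d by (simp add: dist_norm)
      then have "x - of_real d \<in> ?S" using d by blast
      then show ?thesis by simp
    qed
    then have r: "Re x - d > -1" by simp
    define M where "M = (\<lambda>n. ((norm x + d) * (norm x + d + 1)) * real (Suc n) powr (- (Re x - d) - 2))"
    have "uniform_limit (cball x d) (\<lambda>n s. \<Sum>i<n. zeta_trapezoid i s)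
            (\<lambda>s. \<Sum>n. zeta_trapezoid n s) sequentially"
    proof (rule Weierstrass_m_test[where M = M])
      show "summable M" unfolding M_def using r by (intro summable_mult summable_Suc_powr) simp
      fix n s assume s: "s \<in> cball x d"
      have "Re s \<ge> Re x - d"
        using s abs_Re_le_cmod[of "x - s"] by (simp add: dist_norm)
      have ns: "norm s \<le> norm x + d"
        using s norm_triangle_sub[of s x] by (simp add: dist_norm norm_minus_commute)
      have "norm (zeta_trapezoid n s) \<le> norm (s * (s + 1)) * real (Suc n) powr (- Re s - 2)"
        using s d r \<open>Re s \<ge> Re x - d\<close> by (intro norm_zeta_trapezoid_le) auto
      also have "norm (s * (s + 1)) \<le> (norm x + d) * (norm x + d + 1)"
        unfolding norm_mult using ns norm_triangle_ineq[of s 1] d by (intro mult_mono) auto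
      also have "real (Suc n) powr (- Re s - 2) \<le> real (Suc n) powr (- (Re x - d) - 2)"
        using \<open>Re s \<ge> Re x - d\<close> by (intro powr_mono) auto
      finally show "norm (zeta_trapezoid n s) \<le> M n"
        using d by (simp add: M_def mult_left_mono)
    qed
    with d show "\<exists>d>0. cball x d \<subseteq> ?S \<and> uniform_limit (cball x d)
       (\<lambda>n s. \<Sum>i<n. zeta_trapezoid i s) (\<lambda>s. \<Sum>n. zeta_trapezoid n s) sequentially"
      by blast
  qed
  then show ?thesis
    unfolding zeta_right_def by (intro holomorphic_intros) auto
qed

lemma zeta_right_sums:
  assumes "Re s > 1"
  shows "(\<lambda>n. 1 / of_nat (Suc n) powr s) sums zeta_right s"
proof -
  have s: "s \<noteq> 1" using assms by auto
  have lim: "(\<lambda>N. complex_of_nat (Suc N) powr z) \<longlonglongrightarrow> 0" if "Re z < 0" for z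
  proof (rule tendsto_norm_zero_cancel)
    have "(\<lambda>N. real (Suc N) powr Re z) \<longlonglongrightarrow> 0"
      using that by (intro tendsto_neg_powr filterlim_compose[OF filterlim_real_sequentially filterlim_Suc]) auto
    then show "(\<lambda>N. norm (complex_of_nat (Suc N) powr z)) \<longlonglongrightarrow> 0"
      by (simp add: norm_powr_real_powr del: of_nat_Suc)
  qed
  \<comment> \<open>The rule summed from 1 to \<open>N + 1\<close> and solved for the partial sum.
    The two boundary terms at \<open>Suc N\<close> tend to 0 because
    \<open>Re s > 1\<close>.\<close>
  have part: "(\<Sum>n<N. 1 / of_nat (Suc n) powr s) = (\<Sum>n<N. zeta_trapezoid n s) + 1 / 2
      + 1 / (s - 1) - of_nat (Suc N) powr (- s) / 2 + of_nat (Suc N) powr (1 - s) / (1 - s)" for N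
  proof (induction N)
    case 0
    show ?case using s by (simp add: field_simps)
  next
    case (Suc N)
    have "1 / complex_of_nat (Suc N) powr s = of_nat (Suc N) powr (- s)"
      by (simp add: powr_minus divide_inverse)
    then show ?case
      unfolding sum.lessThan_Suc Suc.IH zeta_trapezoid_def by (simp add: diff_divide_distrib add_divide_distrib)
  qed
  have "(\<lambda>N. (\<Sum>n<N. zeta_trapezoid n s) + 1 / 2
      + 1 / (s - 1) - of_nat (Suc N) powr (- s) / 2 + of_nat (Suc N) powr (1 - s) / (1 - s))
      \<longlonglongrightarrow> (\<Sum>n. zeta_trapezoid n s) + 1 / 2 + 1 / (s - 1) - 0 / 2 + 0 / (1 - s)"
    using assms s by (intro tendsto_intros lim summable_LIMSEQ summable_zeta_trapezoid) auto
  then show ?thesis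
    unfolding sums_def part by (simp add: zeta_right_def algebra_simps)
qed

section \<open>Partial fractions and Mellin integrals\<close>

text \<open>Both sides of the reflection formula for \<open>Gamma\<close> are differentiated; the
  common nonzero factor \<open>pi / sin (pi * z)\<close> is then cancelled.\<close>

lemma Digamma_reflection_complex:
  fixes z :: complex
  assumes "z \<notin> \<int>"
  shows "Digamma (1 - z) - Digamma z = of_real pi * cot (of_real pi * z)"
proof -
  have sin: "sin (of_real pi * z) \<noteq> 0"
  proof
    assume "sin (of_real pi * z) = 0"
    then obtain n :: int where "of_real pi * z = of_real (of_int n * pi)"
      by (auto simp: sin_eq_0)
    then have "z = of_int n" by simp
    with assms show False by simp
  qed
  have nz: "z \<notin> \<int>\<^sub>\<le>\<^sub>0" "1 - z \<notin> \<int>\<^sub>\<le>\<^sub>0"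
  proof -
    show "z \<notin> \<int>\<^sub>\<le>\<^sub>0" using assms nonpos_Ints_subset_Ints by blast
    have "1 - z \<notin> \<int>" using assms Ints_diff[of 1 "1 - z"] by auto
    then show "1 - z \<notin> \<int>\<^sub>\<le>\<^sub>0" using nonpos_Ints_subset_Ints by blast
  qed
  have "((\<lambda>w. Gamma w * Gamma (1 - w)) has_field_derivative
          Gamma z * Gamma (1 - z) * (Digamma z - Digamma (1 - z))) (at z)"
    using nz by (auto intro!: derivative_eq_intros simp: algebra_simps)
  moreover have "((\<lambda>w. of_real pi / sin (of_real pi * w)) has_field_derivative
          - (of_real pi / sin (of_real pi * z) * (of_real pi * cot (of_real pi * z)))) (at z)"
    using sin by (auto intro!: derivative_eq_intros simp: cot_def power2_eq_square)
  ultimately have "Gamma z * Gamma (1 - z) * (Digamma z - Digamma (1 - z)) =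
      - (of_real pi / sin (of_real pi * z) * (of_real pi * cot (of_real pi * z)))"
    unfolding Gamma_reflection_complex by (rule DERIV_unique)
  then have "of_real pi / sin (of_real pi * z) *
      (Digamma (1 - z) - Digamma z - of_real pi * cot (of_real pi * z)) = 0"
    unfolding Gamma_reflection_complex by (simp add: algebra_simps)
  then show ?thesis using sin by simp
qed

text \<open>In the difference of the \<open>Digamma\<close> series at \<open>1 + z\<close> and
  \<open>1 - z\<close> the terms \<open>inverse (of_nat (Suc k))\<close> and the Euler constant
  cancel; the recurrence and the reflection formula evaluate the difference.\<close>

lemma cot_partial_fractions:
  fixes z :: complex
  assumes "z \<notin> \<int>"
  shows "(\<lambda>k. inverse (1 - z + of_nat k) - inverse (1 + z + of_nat k)) sums
           (1 / z - of_real pi * cot (of_real pi * z))"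
proof -
  have nz: "1 + z \<noteq> 0" "1 - z \<noteq> 0" "z \<noteq> 0"
    using assms Ints_minus[of 1] by (auto simp: add_eq_0_iff)
  have "(\<lambda>k. inverse (of_nat (Suc k)) - inverse (w + of_nat k)) sums
          (Digamma w + euler_mascheroni)" if "w \<noteq> 0" for w :: complex
    using summable_Digamma[OF that] unfolding Digamma_def by (simp add: summable_sums)
  from sums_diff[OF this[OF nz(1)] this[OF nz(2)]]
  have "(\<lambda>k. inverse (1 - z + of_nat k) - inverse (1 + z + of_nat k)) sums
      (Digamma (z + 1) - Digamma (1 - z))"
    by (simp add: add_ac)
  also have "Digamma (z + 1) - Digamma (1 - z) = 1 / z - of_real pi * cot (of_real pi * z)"
    unfolding Digamma_plus1[OF nz(3)] Digamma_reflection_complex[OF assms, symmetric] by simp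
  finally show ?thesis .
qed

text \<open>The cotangent expansion at \<open>z = \<i> * x / (2 * pi)\<close>, divided by
  \<open>2 * pi * \<i>\<close>. Up to the factor \<open>- \<i>\<close> the cotangent becomes coth (x
  / 2), and half of that is \<open>1 / (exp x - 1) + 1 / 2\<close>.\<close>

lemma bose_kernel_partial_fractions:
  fixes x :: real
  assumes "x > 0"
  shows "(\<lambda>n. 2 * x / (x\<^sup>2 + (2 * pi * real (Suc n))\<^sup>2)) sums (1 / (exp x - 1) + 1 / 2 - 1 / x)"
proof -
  define z where "z = \<i> * of_real (x / (2 * pi))"
  have z: "z \<notin> \<int>"
  proof
    assume "z \<in> \<int>"
    then have "Im z = 0" by (auto elim: Ints_cases)
    with assms show False by (simp add: z_def)
  qed
  from sums_mult[OF cot_partial_fractions[OF z], of "1 / (2 * of_real pi * \<i>)"]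
  have "(\<lambda>k. 1 / (2 * of_real pi * \<i>) * (inverse (1 - z + of_nat k) - inverse (1 + z + of_nat k)))
      sums (1 / (2 * of_real pi * \<i>) * (1 / z - of_real pi * cot (of_real pi * z)))" .
  also have "(\<lambda>k. 1 / (2 * of_real pi * \<i>) * (inverse (1 - z + of_nat k) - inverse (1 + z + of_nat k)))
     = (\<lambda>k. complex_of_real (2 * x / (x\<^sup>2 + (2 * pi * real (Suc k))\<^sup>2)))"
  proof
    fix k
    have nz: "of_nat (Suc k) - z \<noteq> 0" "of_nat (Suc k) + z \<noteq> 0"
      by (auto simp: z_def complex_eq_iff)
    have D: "complex_of_real (x\<^sup>2 + (2 * pi * real (Suc k))\<^sup>2) \<noteq> 0"
      using assms by (simp only: of_real_eq_0_iff) (simp add: sum_power2_eq_zero_iff)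
    have "inverse (1 - z + of_nat k) - inverse (1 + z + of_nat k)
       = 2 * z / ((of_nat (Suc k) - z) * (of_nat (Suc k) + z))"
      using nz by (simp add: field_simps)
    also have "4 * of_real pi ^ 2 * ((of_nat (Suc k) - z) * (of_nat (Suc k) + z)) =
        complex_of_real (x\<^sup>2 + (2 * pi * real (Suc k))\<^sup>2)"
      by (simp add: z_def field_simps power2_eq_square)
    then have "(of_nat (Suc k) - z) * (of_nat (Suc k) + z) =
        complex_of_real (x\<^sup>2 + (2 * pi * real (Suc k))\<^sup>2) / (4 * of_real pi ^ 2)"
      by (simp add: field_simps)
    finally have "1 / (2 * of_real pi * \<i>) * (inverse (1 - z + of_nat k) - inverse (1 + z + of_nat k))
      = 1 / (2 * of_real pi * \<i>) * (2 * z / (complex_of_real (x\<^sup>2 + (2 * pi * real (Suc k))\<^sup>2) / (4 * of_real pi ^ 2)))"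
      by simp
    also have "\<dots> = 2 * of_real x / complex_of_real (x\<^sup>2 + (2 * pi * real (Suc k))\<^sup>2)"
      using D by (simp add: z_def power2_eq_square del: of_real_add of_real_power)
    finally show "1 / (2 * of_real pi * \<i>) * (inverse (1 - z + of_nat k) - inverse (1 + z + of_nat k))
       = complex_of_real (2 * x / (x\<^sup>2 + (2 * pi * real (Suc k))\<^sup>2))"
      by simp
  qed
  also have "1 / (2 * of_real pi * \<i>) * (1 / z - of_real pi * cot (of_real pi * z)) =
     complex_of_real (1 / (exp x - 1) + 1 / 2 - 1 / x)"
  proof -
    \<comment> \<open>In terms of \<open>u\<close> the cotangent is a rational expression.\<close>
    define u where "u = exp (x / 2)"
    have u: "u > 1" using assms by (simp add: u_def)
    have e: "exp x = u * u" by (simp add: u_def flip: exp_add)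
    have w: "of_real pi * z = \<i> * of_real (x / 2)" by (simp add: z_def)
    have "\<i> * (\<i> * of_real (x / 2)) = complex_of_real (- (x / 2))" by simp
    then have ex: "exp (\<i> * (\<i> * of_real (x / 2))) = of_real (inverse u)"
      "exp (- (\<i> * (\<i> * of_real (x / 2)))) = of_real u"
      by (simp_all only: exp_of_real of_real_minus[symmetric] minus_minus u_def exp_minus)
    have "cot (\<i> * of_real (x / 2)) = - \<i> * (of_real u + inverse (of_real u)) / (of_real u - inverse (of_real u))"
    proof -
      \<comment> \<open>For \<open>A = B\<close> both sides are 0, since division by zero gives
        0.\<close>
      have "((A + B) / 2) / ((A - B) / (2 * \<i>)) = - \<i> * (B + A) / (B - A)" for A B :: complex
        by (cases "A = B") (auto simp: field_simps)
      then show ?thesis unfolding cot_def cos_exp_eq sin_exp_eq ex by simp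
    qed
    also have "\<dots> = - \<i> * of_real ((u + inverse u) / (u - inverse u))" by simp
    also have "(u + inverse u) / (u - inverse u) = 1 + 2 * (1 / (u * u - 1))"
    proof -
      have "u * u - 1 > 0" using u mult_strict_mono[of 1 u 1 u] by simp
      moreover have "u - inverse u = (u * u - 1) / u" "u + inverse u = (u * u + 1) / u"
        using u by (simp_all add: field_simps)
      ultimately show ?thesis using u by (simp add: field_simps)
    qed
    finally have "cot (of_real pi * z) = - \<i> * of_real (1 + 2 * (1 / (exp x - 1)))"
      unfolding w e .
    moreover have "1 / (2 * of_real pi * \<i>) * (1 / z) = - complex_of_real (1 / x)"
      using assms by (simp add: z_def)
    moreover have "1 / (2 * of_real pi * \<i>) * (of_real pi * (- \<i> * complex_of_real (1 + 2 * v))) = - complex_of_real (1 / 2 + v)" for v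
      by (simp add: add_divide_distrib)
    ultimately show ?thesis
      by (simp only: right_diff_distrib) simp
  qed
  finally show ?thesis by (subst (asm) sums_of_real_iff)
qed

section \<open>Mellin integrals of the single terms\<close>

text \<open>The substitution \<open>g x = x\<^sup>2 / (x\<^sup>2 + c\<^sup>2)\<close> maps the
  half-line onto the unit interval and produces a Beta integral. Its parameters \<open>p\<close> and
  \<open>q\<close> add up to 1, so its value is the bare product of two Gamma values.\<close>

lemma nn_integral_powr_over_quadratic:
  fixes a c :: real
  assumes a: "0 < a" "a < 1" and c: "c > 0"
  shows "(\<integral>\<^sup>+x. ennreal (indicator {0<..} x * (2 * x powr (- a) / (x\<^sup>2 + c\<^sup>2))) \<partial>lborel) =
           ennreal (c powr (- a - 1) * (Gamma ((1 - a) / 2) * Gamma ((1 + a) / 2)))"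
proof -
  define p q where "p = (1 - a) / 2" and "q = (1 + a) / 2"
  have pq: "p > 0" "q > 0" "p + q = 1" using a by (auto simp: p_def q_def field_simps)
  define f where "f = (\<lambda>t::real. t powr (p - 1) * (1 - t) powr (q - 1))"
  define g where "g = (\<lambda>x::real. x\<^sup>2 / (x\<^sup>2 + c\<^sup>2))"
  define g' where "g' = (\<lambda>x::real. 2 * x * c\<^sup>2 / (x\<^sup>2 + c\<^sup>2)\<^sup>2)"
  have pos: "x\<^sup>2 + c\<^sup>2 > 0" for x :: real using c by (simp add: pos_add_strict add_nonneg_pos)
  have lt: "g x < 1" if "x > 0" for x using pos[of x] c by (simp add: g_def)
  \<comment> \<open>The explicit inverse of \<open>g\<close> gives injectivity; the same formula
    supplies the preimages in the computation of the range.\<close>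
  have inv: "x = c * sqrt (g x / (1 - g x))" if "x > 0" for x
  proof -
    have "1 - g x = c\<^sup>2 / (x\<^sup>2 + c\<^sup>2)" using less_imp_neq[OF pos[of x]] by (simp add: g_def diff_eq_eq flip: add_divide_distrib)
    then have "g x / (1 - g x) = (x / c)\<^sup>2"
      using pos[of x] c by (simp add: g_def power_divide)
    then show ?thesis using that c by simp
  qed
  have img: "g ` {0<..} = {0<..<1}"
  proof (intro equalityI subsetI)
    fix y assume "y \<in> g ` {0<..}"
    then show "y \<in> {0<..<1}" using lt pos by (auto simp: g_def)
  next
    fix y :: real assume y: "y \<in> {0<..<1}"
    have "g (c * sqrt (y / (1 - y))) = y"
      using y c by (simp add: g_def power_mult_distrib real_sqrt_divide power_divide field_simps)
    moreover have "c * sqrt (y / (1 - y)) > 0" using y c by simp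
    ultimately show "y \<in> g ` {0<..}" by (metis greaterThan_iff imageI)
  qed
  have "(f has_integral Beta p q) {0<..<1}"
    unfolding f_def using has_integral_Beta_real[OF pq(1,2)] by (simp add: has_integral_Icc_iff_Ioo)
  then have "f absolutely_integrable_on (g ` {0<..}) \<and> integral (g ` {0<..}) f = Beta p q"
    unfolding img by (auto intro!: nonnegative_absolutely_integrable_1 simp: f_def has_integral_iff)
  moreover have "(\<lambda>x. \<bar>g' x\<bar> * f (g x)) absolutely_integrable_on {0<..} \<and>
      integral {0<..} (\<lambda>x. \<bar>g' x\<bar> * f (g x)) = Beta p q \<longleftrightarrow>
      f absolutely_integrable_on (g ` {0<..}) \<and> integral (g ` {0<..}) f = Beta p q"
  proof (rule has_absolute_integral_change_of_variables_1')
    show "(g has_field_derivative g' x) (at x within {0<..})" for x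
      unfolding g_def g'_def using pos[of x]
      by (auto intro!: derivative_eq_intros simp: power2_eq_square field_simps)
    show "inj_on g {0<..}" by (rule inj_onI) (metis inv greaterThan_iff)
  qed auto
  ultimately have "((\<lambda>x. \<bar>g' x\<bar> * f (g x)) has_integral Beta p q) {0<..}"
    using set_lebesgue_integral_eq_integral(1) by (metis has_integral_iff)
  then have "((\<lambda>x. c powr (- a - 1) * (\<bar>g' x\<bar> * f (g x))) has_integral c powr (- a - 1) * Beta p q) {0<..}"
    by (rule has_integral_mult_right)
  also have "?this \<longleftrightarrow> ((\<lambda>x. 2 * x powr (- a) / (x\<^sup>2 + c\<^sup>2)) has_integral c powr (- a - 1) * Beta p q) {0<..}"
  proof (rule has_integral_cong)
    fix x :: real assume "x \<in> {0<..}"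
    then have x: "x > 0" by simp
    define D where "D = x\<^sup>2 + c\<^sup>2"
    have D: "D > 0" using pos by (simp add: D_def)
    have e1: "1 - g x = c\<^sup>2 / D" using less_imp_neq[OF D] by (simp add: g_def D_def diff_eq_eq flip: add_divide_distrib)
    have "f (g x) = (x\<^sup>2) powr (p - 1) * (c\<^sup>2) powr (q - 1) / (D powr (p - 1) * D powr (q - 1))"
      unfolding f_def e1 using x c D by (simp add: g_def D_def[symmetric] powr_divide)
    also have "D powr (p - 1) * D powr (q - 1) = D powr (- 1)"
      unfolding powr_add[symmetric] using pq(3) by (simp add: algebra_simps)
    also have "(x\<^sup>2) powr (p - 1) = x powr (- a - 1)"
    proof -
      have "(x\<^sup>2) powr (p - 1) = x powr (2 * (p - 1))"
        using x by (simp add: powr_powr flip: powr_numeral)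
      also have "2 * (p - 1) = - a - 1" by (simp add: p_def)
      finally show ?thesis .
    qed
    also have "(c\<^sup>2) powr (q - 1) = c powr (a - 1)"
    proof -
      have "(c\<^sup>2) powr (q - 1) = c powr (2 * (q - 1))"
        using c by (simp add: powr_powr flip: powr_numeral)
      also have "2 * (q - 1) = a - 1" by (simp add: q_def)
      finally show ?thesis .
    qed
    finally have "f (g x) = x powr (- a - 1) * c powr (a - 1) * D"
      using D by (simp add: powr_minus divide_inverse)
    moreover have "x powr (- a - 1) = x powr (- a) / x" "c powr (- a - 1) * (c powr (a - 1) * c\<^sup>2) = 1"
      using x c by (simp_all add: powr_diff powr_minus field_simps power2_eq_square)
    moreover have "\<bar>g' x\<bar> = 2 * x * c\<^sup>2 / D\<^sup>2" using x by (simp add: g'_def D_def)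
    moreover have "A * (2 * x * c\<^sup>2 / D\<^sup>2 * (X / x * B * D)) = (A * (B * c\<^sup>2)) * (2 * X / D)" for A B X
      using x D by (simp add: power2_eq_square field_simps)
    ultimately have "c powr (- a - 1) * (\<bar>g' x\<bar> * f (g x)) = 1 * (2 * x powr (- a) / D)"
      by (simp only:)
    then show "c powr (- a - 1) * (\<bar>g' x\<bar> * f (g x)) = 2 * x powr (- a) / (x\<^sup>2 + c\<^sup>2)"
      by (simp add: D_def)
  qed
  finally have "(\<integral>\<^sup>+x. ennreal (indicator {0<..} x * (2 * x powr (- a) / (x\<^sup>2 + c\<^sup>2))) \<partial>lborel) =
       ennreal (c powr (- a - 1) * Beta p q)"
    by (intro nn_integral_has_integral_lebesgue) (auto intro!: divide_nonneg_pos pos)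
  then show ?thesis
    using pq by (simp add: Beta_def p_def q_def)
qed

lemma nn_integral_Gamma_scaled:
  fixes s y :: real
  assumes "s > 0" "y > 0"
  shows "(\<integral>\<^sup>+x. ennreal (indicator {0<..} x * (x powr (s - 1) * exp (- y * x))) \<partial>lborel) =
           ennreal (Gamma s * y powr (- s))"
proof -
  have "ennreal (Gamma s) = (\<integral>\<^sup>+x. ennreal (indicator {0..} x * x powr (s - 1) / exp x) \<partial>lborel)"
    by (rule Gamma_conv_nn_integral_real) fact
  also have "\<dots> = ennreal \<bar>y\<bar> * (\<integral>\<^sup>+x. ennreal (indicator {0..} (0 + y * x) * (0 + y * x) powr (s - 1) / exp (0 + y * x)) \<partial>lborel)"
    using assms by (intro nn_integral_real_affine) auto
  \<comment> \<open>At \<open>x = 0\<close> both integrands vanish because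
    \<open>0 powr b = 0\<close>, so passing from the closed to the open half-line is a pointwise
    equality.\<close>
  also have "\<dots> = (\<integral>\<^sup>+x. ennreal (y powr s) * ennreal (indicator {0<..} x * (x powr (s - 1) * exp (- y * x))) \<partial>lborel)"
    apply (subst nn_integral_cmult[symmetric])
     apply simp
    using assms
    by (intro nn_integral_cong)
       (auto simp: ennreal_mult'[symmetric] indicator_def powr_mult powr_diff exp_minus zero_le_mult_iff field_simps intro!: arg_cong[where f = ennreal])
  also have "\<dots> = ennreal (y powr s) * (\<integral>\<^sup>+x. ennreal (indicator {0<..} x * (x powr (s - 1) * exp (- y * x))) \<partial>lborel)"
    by (intro nn_integral_cmult) auto
  \<comment> \<open>Multiplying by \<open>y powr (- s)\<close> isolates the integral without having
    to know that it is finite.\<close>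
  finally have "ennreal (y powr (- s)) * ennreal (Gamma s) = ennreal (y powr (- s)) * ennreal (y powr s) * (\<integral>\<^sup>+x. ennreal (indicator {0<..} x * (x powr (s - 1) * exp (- y * x))) \<partial>lborel)"
    by (simp add: mult.assoc)
  also have "ennreal (y powr (- s)) * ennreal (y powr s) = 1"
    using assms by (simp add: ennreal_mult'[symmetric] flip: powr_add)
  finally show ?thesis
    using assms by (simp add: ennreal_mult''[symmetric] less_imp_le[OF Gamma_real_pos] mult_ac)
qed

section \<open>The second expansion of the kernel, by trapezoidal errors of exponentials\<close>

text \<open>The trapezoidal error of the exponential with rate \<open>- x\<close> between
  \<open>n\<close> and \<open>n + 1\<close>. It depends on \<open>n\<close> only through the factor
  \<open>exp (- x) ^ n\<close>, so summing over \<open>n\<close> is a geometric series.\<close>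

lemma has_integral_trapezoid_exp:
  fixes x :: real
  assumes x: "x > 0"
  shows "((\<lambda>t. t * (1 - t) / 2 * (x\<^sup>2 * exp (- (real n + t) * x))) has_integral
           ((1 + exp (- x)) / 2 - (1 - exp (- x)) / x) * exp (- x) ^ n) {0..1}"
proof -
  let ?e = "\<lambda>t. exp (- (real n + t) * x)"
  have "((\<lambda>t. (t * (1 - t) / 2) *\<^sub>R (x\<^sup>2 * ?e t)) has_integral
     (1 / 2) *\<^sub>R (?e 0 + ?e 1) - ((- ?e 1 / x) - (- ?e 0 / x))) {0..1}"
    by (rule trapezoid_error_has_integral[where f' = "\<lambda>t. - x * ?e t"])
       (use x in \<open>auto intro!: derivative_eq_intros simp: has_real_derivative_iff_has_vector_derivative[symmetric] power2_eq_square\<close>)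
  moreover have "?e 0 = exp (- x) ^ n" "?e 1 = exp (- x) * exp (- x) ^ n"
    by (simp_all add: algebra_simps exp_diff exp_minus divide_inverse power_inverse flip: exp_of_nat_mult)
  ultimately show ?thesis by (simp add: diff_divide_distrib add_divide_distrib algebra_simps)
qed

lemma suminf_nn_integral_trapezoid_exp:
  fixes x :: real
  assumes x: "x > 0"
  shows "(\<Sum>n. \<integral>\<^sup>+t. ennreal (indicator {0..1} t * (t * (1 - t) / 2 * (x\<^sup>2 * exp (- (real n + t) * x)))) \<partial>lborel)
           = ennreal (1 / (exp x - 1) + 1 / 2 - 1 / x)"
proof -
  define h where "h = (\<lambda>n. ((1 + exp (- x)) / 2 - (1 - exp (- x)) / x) * exp (- x) ^ n)"
  have nn: "(\<integral>\<^sup>+t. ennreal (indicator {0..1} t * (t * (1 - t) / 2 * (x\<^sup>2 * exp (- (real n + t) * x)))) \<partial>lborel) = ennreal (h n)" for n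
    unfolding h_def by (rule nn_integral_has_integral_lebesgue[OF _ has_integral_trapezoid_exp[OF x]]) auto
  have h0: "h n \<ge> 0" for n
    unfolding h_def by (rule has_integral_nonneg[OF has_integral_trapezoid_exp[OF x]]) auto
  have "h sums (((1 + exp (- x)) / 2 - (1 - exp (- x)) / x) * (1 / (1 - exp (- x))))"
    unfolding h_def by (intro sums_mult geometric_sums) (use x in simp)
  also have "((1 + exp (- x)) / 2 - (1 - exp (- x)) / x) * (1 / (1 - exp (- x))) = 1 / (exp x - 1) + 1 / 2 - 1 / x"
  proof -
    have "exp x - 1 > 0" using x by simp
    moreover have "1 - exp (- x) = (exp x - 1) / exp x" "1 + exp (- x) = (exp x + 1) / exp x"
      by (simp_all add: exp_minus field_simps)
    ultimately show ?thesis using x by (simp add: field_simps)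
  qed
  finally have "h sums (1 / (exp x - 1) + 1 / 2 - 1 / x)" .
  then show ?thesis unfolding nn by (intro suminf_ennreal_eq h0)
qed

lemma Gamma_prod_complementary:
  fixes a :: real
  assumes "\<bar>a\<bar> < 1"
  shows "Gamma ((1 - a) / 2) * Gamma ((1 + a) / 2) = pi / cos (pi * a / 2)"
proof -
  have e: "1 - complex_of_real ((1 - a) / 2) = of_real ((1 + a) / 2)"
    by (simp add: field_simps)
  have "complex_of_real (Gamma ((1 - a) / 2) * Gamma ((1 + a) / 2)) =
      Gamma (of_real ((1 - a) / 2)) * Gamma (1 - of_real ((1 - a) / 2))"
    unfolding e Gamma_complex_of_real by simp
  also have "\<dots> = of_real (pi / sin (pi * ((1 - a) / 2)))"
    unfolding Gamma_reflection_complex by (metis of_real_divide of_real_mult sin_of_real)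
  finally have "Gamma ((1 - a) / 2) * Gamma ((1 + a) / 2) = pi / sin (pi * ((1 - a) / 2))"
    by (simp only: of_real_eq_iff)
  also have "pi * ((1 - a) / 2) = pi / 2 - pi * a / 2" by (simp add: field_simps)
  also have "sin (pi / 2 - pi * a / 2) = cos (pi * a / 2)" by (simp add: sin_diff)
  finally show ?thesis .
qed

text \<open>Both sides are the Mellin transform of \<open>1 / (exp x - 1) + 1 / 2 - 1 / x\<close> at \<open>- a\<close>,
  computed from two expansions of this kernel into nonnegative functions.\<close>

lemma trapezoid_Mellin_identity:
  fixes a :: real
  assumes a: "0 < a" "a < 1"
  shows "ennreal (Gamma (2 - a)) * (\<Sum>n. \<integral>\<^sup>+t. ennreal (indicator {0..1} t * (t * (1 - t) / 2 * (real n + t) powr (a - 2))) \<partial>lborel)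
       = (\<Sum>m. ennreal ((2 * pi * real (Suc m)) powr (- a - 1) * (pi / cos (pi * a / 2))))"
proof -
  let ?k = "\<lambda>t::real. indicator {0..1} t * (t * (1 - t) / 2)"
  let ?w = "\<lambda>x::real. indicator {0<..} x * x powr (- a - 1)"
  let ?e = "\<lambda>n x t. ennreal (indicator {0..1} t * (t * (1 - t) / 2 * (x\<^sup>2 * exp (- (real n + t) * x))))"
  \<comment> \<open>Euler's integral represents
    \<open>Gamma (2 - a) * (real n + t) powr (a - 2)\<close>; its power of \<open>x\<close> is split
    as \<open>x powr (- a - 1) * x\<^sup>2\<close> so that the trapezoidal error of the exponential
    appears. With \<open>t \<noteq> 0\<close> the base \<open>real n + t\<close> is positive on the
    unit interval even for \<open>n = 0\<close>.\<close>
  have kernel: "ennreal (Gamma (2 - a)) * ennreal (indicator {0..1} t * (t * (1 - t) / 2 * (real n + t) powr (a - 2)))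
      = (\<integral>\<^sup>+x. ennreal (?w x) * ?e n x t \<partial>lborel)" if "t \<noteq> 0" for n t
  proof (cases "t \<in> {0..1}")
    case False
    then have "indicator {0..1} t = (0::real)" by simp
    then show ?thesis by (simp only: mult_zero_left ennreal_0 mult_zero_right nn_integral_const)
  next
    case True
    then have y: "real n + t > 0" using that by simp
    have k0: "0 \<le> t * (1 - t) / 2" using True by simp
    have "(\<integral>\<^sup>+x. ennreal (?w x) * ?e n x t \<partial>lborel) =
       (\<integral>\<^sup>+x. ennreal (t * (1 - t) / 2) * ennreal (indicator {0<..} x * (x powr ((2 - a) - 1) * exp (- (real n + t) * x))) \<partial>lborel)"
    proof (intro nn_integral_cong)
      fix x :: real
      show "ennreal (?w x) * ?e n x t = ennreal (t * (1 - t) / 2) * ennreal (indicator {0<..} x * (x powr ((2 - a) - 1) * exp (- (real n + t) * x)))"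
      proof (cases "x > 0")
        case xp: True
        have "x powr (- a - 1) * x\<^sup>2 = x powr ((2 - a) - 1)"
          using xp by (simp flip: powr_numeral powr_add)
        moreover have "w * x2 = v \<Longrightarrow> w * (k * (x2 * e)) = k * (v * e)" for w x2 v k e :: real
          by (auto simp: mult_ac)
        ultimately have "x powr (- a - 1) * (t * (1 - t) / 2 * (x\<^sup>2 * exp (- (real n + t) * x))) =
            t * (1 - t) / 2 * (x powr ((2 - a) - 1) * exp (- (real n + t) * x))"
          by blast
        then show ?thesis
          using xp True k0 by (simp add: ennreal_mult'[symmetric] ennreal_mult''[symmetric])
      qed auto
    qed
    also have "\<dots> = ennreal (t * (1 - t) / 2) * ennreal (Gamma (2 - a) * (real n + t) powr (- (2 - a)))"
      using a y by (subst nn_integral_cmult, simp, subst nn_integral_Gamma_scaled) auto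
    also have "\<dots> = ennreal (Gamma (2 - a)) * ennreal (indicator {0..1} t * (t * (1 - t) / 2 * (real n + t) powr (a - 2)))"
      using a True k0 Gamma_real_pos[of "2 - a"]
      by (simp add: ennreal_mult'[symmetric] ennreal_mult''[symmetric] mult_ac)
    finally show ?thesis ..
  qed
  have "ennreal (Gamma (2 - a)) * (\<Sum>n. \<integral>\<^sup>+t. ennreal (indicator {0..1} t * (t * (1 - t) / 2 * (real n + t) powr (a - 2))) \<partial>lborel)
      = (\<Sum>n. \<integral>\<^sup>+t. ennreal (Gamma (2 - a)) * ennreal (indicator {0..1} t * (t * (1 - t) / 2 * (real n + t) powr (a - 2))) \<partial>lborel)"
    by (subst ennreal_suminf_cmult[symmetric], subst nn_integral_cmult) auto
  \<comment> \<open>The point \<open>t = 0\<close> is a null set.\<close>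
  also have "\<dots> = (\<Sum>n. \<integral>\<^sup>+t. \<integral>\<^sup>+x. ennreal (?w x) * ?e n x t \<partial>lborel \<partial>lborel)"
    by (intro suminf_cong nn_integral_cong_AE AE_mp[OF AE_lborel_singleton[of 0] AE_I2] impI kernel)
  \<comment> \<open>Tonelli: all functions are nonnegative, so the order of integration is
    free.\<close>
  also have "\<dots> = (\<Sum>n. \<integral>\<^sup>+x. \<integral>\<^sup>+t. ennreal (?w x) * ?e n x t \<partial>lborel \<partial>lborel)"
    by (intro suminf_cong lborel_pair.Fubini') (auto simp: case_prod_beta)
  also have "\<dots> = (\<Sum>n. \<integral>\<^sup>+x. ennreal (?w x) * (\<integral>\<^sup>+t. ?e n x t \<partial>lborel) \<partial>lborel)"
    by (subst nn_integral_cmult) auto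
  also have "\<dots> = (\<integral>\<^sup>+x. (\<Sum>n. ennreal (?w x) * (\<integral>\<^sup>+t. ?e n x t \<partial>lborel)) \<partial>lborel)"
    by (intro nn_integral_suminf[symmetric]) auto
  also have "\<dots> = (\<integral>\<^sup>+x. (\<Sum>m. ennreal (indicator {0<..} x * (2 * x powr (- a) / (x\<^sup>2 + (2 * pi * real (Suc m))\<^sup>2)))) \<partial>lborel)"
  proof (intro nn_integral_cong)
    fix x :: real
    show "(\<Sum>n. ennreal (?w x) * (\<integral>\<^sup>+t. ?e n x t \<partial>lborel)) =
       (\<Sum>m. ennreal (indicator {0<..} x * (2 * x powr (- a) / (x\<^sup>2 + (2 * pi * real (Suc m))\<^sup>2))))"
    proof (cases "x > 0")
      case x: True
      have "(\<Sum>n. ennreal (?w x) * (\<integral>\<^sup>+t. ?e n x t \<partial>lborel)) =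
          ennreal (?w x) * ennreal (1 / (exp x - 1) + 1 / 2 - 1 / x)"
        by (simp only: ennreal_suminf_cmult suminf_nn_integral_trapezoid_exp[OF x])
      \<comment> \<open>The trapezoidal expansion has been summed to the closed kernel; here it is
        exchanged for the partial fractions.\<close>
      also have "ennreal (1 / (exp x - 1) + 1 / 2 - 1 / x) = (\<Sum>m. ennreal (2 * x / (x\<^sup>2 + (2 * pi * real (Suc m))\<^sup>2)))"
        using x by (intro suminf_ennreal_eq[symmetric] bose_kernel_partial_fractions) auto
      also have "ennreal (?w x) * \<dots> = (\<Sum>m. ennreal (?w x) * ennreal (2 * x / (x\<^sup>2 + (2 * pi * real (Suc m))\<^sup>2)))"
        by simp
      also have "\<dots> = (\<Sum>m. ennreal (indicator {0<..} x * (2 * x powr (- a) / (x\<^sup>2 + (2 * pi * real (Suc m))\<^sup>2))))"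
      proof (intro suminf_cong)
        fix m
        have "x powr (- a - 1) * x = x powr (- a)" using x by (simp add: powr_diff)
        moreover have "w * x = v \<Longrightarrow> w * (2 * x / d) = 2 * v / d" for w v d :: real
          by auto
        ultimately have "x powr (- a - 1) * (2 * x / (x\<^sup>2 + (2 * pi * real (Suc m))\<^sup>2)) = 2 * x powr (- a) / (x\<^sup>2 + (2 * pi * real (Suc m))\<^sup>2)"
          by blast
        then show "ennreal (?w x) * ennreal (2 * x / (x\<^sup>2 + (2 * pi * real (Suc m))\<^sup>2)) = ennreal (indicator {0<..} x * (2 * x powr (- a) / (x\<^sup>2 + (2 * pi * real (Suc m))\<^sup>2)))"
          using x by (simp add: ennreal_mult'[symmetric] del: of_nat_Suc)
      qed
      finally show ?thesis .
    qed auto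
  qed
  also have "\<dots> = (\<Sum>m. \<integral>\<^sup>+x. ennreal (indicator {0<..} x * (2 * x powr (- a) / (x\<^sup>2 + (2 * pi * real (Suc m))\<^sup>2))) \<partial>lborel)"
    by (intro nn_integral_suminf) auto
  also have "\<dots> = (\<Sum>m. ennreal ((2 * pi * real (Suc m)) powr (- a - 1) * (pi / cos (pi * a / 2))))"
    using a by (subst nn_integral_powr_over_quadratic) (auto simp: Gamma_prod_complementary)
  finally show ?thesis .
qed

section \<open>The functional equation for real s in (-1, 0)\<close>

text \<open>For \<open>s = - a\<close> the terms \<open>1 / (s - 1) + 1 / 2\<close> are themselves
  the trapezoidal error of \<open>x powr a\<close> on the unit interval. Hence the value is the
  error series started at 0 instead of 1. Pulling out \<open>s * (s + 1) = - a * (1 - a)\<close>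
  leaves nonnegative terms \<open>J n\<close>.\<close>

lemma zeta_right_neg_real_sums:
  fixes a :: real
  assumes a: "0 < a" "a < 1"
  obtains J where "\<And>n. (\<integral>\<^sup>+t. ennreal (indicator {0..1} t * (t * (1 - t) / 2 * (real n + t) powr (a - 2))) \<partial>lborel) = ennreal (J n)"
    "\<And>n. J n \<ge> 0" "summable J" "zeta_right (of_real (- a)) = of_real (- a * (1 - a) * suminf J)"
proof -
  let ?f = "\<lambda>n t. t * (1 - t) / 2 * (real n + t) powr (a - 2)"
  \<comment> \<open>\<open>J 0\<close> is half the integral of
    \<open>t powr (a - 1) - t powr a\<close>, which is improper at 0; the later terms are
    trapezoidal errors with the index shifted by one.\<close>
  define J where "J = (\<lambda>n. case n of 0 \<Rightarrow> 1 / (2 * a * (a + 1)) | Suc n \<Rightarrow> Re (zeta_trapezoid n (of_real (- a))) / (- a * (1 - a)))"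
  have s: "complex_of_real (- a) \<noteq> 1" "- a * (1 - a) \<noteq> 0"
    using a by (auto simp: complex_eq_iff)
  have trap: "((\<lambda>t. complex_of_real (- a * (1 - a) * ?f (Suc n) t)) has_integral zeta_trapezoid n (of_real (- a))) {0..1}" for n
  proof (rule has_integral_eq[OF _ zeta_trapezoid_has_integral[OF s(1)]])
    fix t :: real assume "t \<in> {0..1}"
    then have "complex_of_real (real (Suc n) + t) powr (- of_real (- a) - 2) = of_real ((real (Suc n) + t) powr (a - 2))"
      by (subst powr_of_real[symmetric]) auto
    then show "complex_of_real (t * (1 - t) / 2) *
      (complex_of_real (- a) * (complex_of_real (- a) + 1) * complex_of_real (real (Suc n) + t) powr (- complex_of_real (- a) - 2)) =
      complex_of_real (- a * (1 - a) * ?f (Suc n) t)"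
      by (simp del: of_nat_Suc)
  qed
  have real: "complex_of_real (Re (zeta_trapezoid n (of_real (- a)))) = zeta_trapezoid n (of_real (- a))" for n
  proof -
    have "((\<lambda>t. 0) has_integral Im (zeta_trapezoid n (of_real (- a)))) {0..1}"
      using has_integral_linear[OF trap bounded_linear_Im] by (simp add: o_def)
    then have "Im (zeta_trapezoid n (of_real (- a))) = 0" by (simp add: has_integral_0_eq)
    then show ?thesis by (simp add: complex_eq_iff)
  qed
  have "(?f n has_integral J n) {0..1}" for n
  proof (cases n)
    case 0
    have "((\<lambda>t. (1 / 2) * (t powr (a - 1) - t powr a)) has_integral
        (1 / 2) * (1 powr (a - 1 + 1) / (a - 1 + 1) - 1 powr (a + 1) / (a + 1))) {0..1}"
      using a by (intro has_integral_mult_right has_integral_diff has_integral_powr_from_0) auto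
    then have "(?f 0 has_integral (1 / 2) * (1 powr (a - 1 + 1) / (a - 1 + 1) - 1 powr (a + 1) / (a + 1))) {0..1}"
    proof (rule has_integral_eq[rotated])
      fix t :: real assume "t \<in> {0..1}"
      then show "(1 / 2) * (t powr (a - 1) - t powr a) = ?f 0 t"
        by (cases "t = 0") (auto simp: powr_diff field_simps power2_eq_square)
    qed
    also have "(1 / 2) * (1 powr (a - 1 + 1) / (a - 1 + 1) - 1 powr (a + 1) / (a + 1)) = J 0"
      using a by (simp add: J_def field_simps)
    finally show ?thesis using 0 by simp
  next
    case (Suc m)
    have "((\<lambda>t. - a * (1 - a) * ?f (Suc m) t) has_integral Re (zeta_trapezoid m (of_real (- a)))) {0..1}"
      using has_integral_linear[OF trap[of m] bounded_linear_Re] by (simp only: o_def Re_complex_of_real)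
    then have "((\<lambda>t. 1 / (- a * (1 - a)) * (- a * (1 - a) * ?f (Suc m) t)) has_integral 1 / (- a * (1 - a)) * Re (zeta_trapezoid m (of_real (- a)))) {0..1}"
      by (rule has_integral_mult_right)
    moreover have "c \<noteq> 0 \<Longrightarrow> 1 / c * (c * y) = y" for c y :: real
      by simp
    note this[OF s(2)]
    ultimately show ?thesis
      unfolding Suc J_def nat.case by (simp only: times_divide_eq_left mult_1_left)
  qed
  note I = this
  have sum: "(\<lambda>n. J (Suc n)) sums (Re (\<Sum>n. zeta_trapezoid n (of_real (- a))) / (- a * (1 - a)))"
    unfolding J_def nat.case using a s
    by (intro sums_divide sums_Re summable_sums summable_zeta_trapezoid) auto
  then have J: "J sums (Re (\<Sum>n. zeta_trapezoid n (of_real (- a))) / (- a * (1 - a)) + J 0)"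
    by (subst sums_Suc_iff[symmetric]) simp
  show ?thesis
  proof
    show "(\<integral>\<^sup>+t. ennreal (indicator {0..1} t * ?f n t) \<partial>lborel) = ennreal (J n)" for n
      by (rule nn_integral_has_integral_lebesgue[OF _ I]) auto
    show "J n \<ge> 0" for n by (rule has_integral_nonneg[OF I]) auto
    show "summable J" using J by (rule sums_summable)
    have "zeta_right (of_real (- a)) = 1 / (of_real (- a) - 1) + 1 / 2 + of_real (Re (\<Sum>n. zeta_trapezoid n (of_real (- a))))"
    proof -
      have "summable (\<lambda>n. zeta_trapezoid n (of_real (- a)))"
        using a s by (intro summable_zeta_trapezoid) auto
      from sums_Re[OF summable_sums[OF this]] 
      have "(\<lambda>n. complex_of_real (Re (zeta_trapezoid n (of_real (- a))))) sums of_real (Re (\<Sum>n. zeta_trapezoid n (of_real (- a))))"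
        by (subst sums_of_real_iff)
      then show ?thesis unfolding real zeta_right_def by (simp add: sums_iff)
    qed
    also have "\<dots> = of_real (- a * (1 - a) * suminf J)"
    proof -
      have "- a * (1 - a) * suminf J = Re (\<Sum>n. zeta_trapezoid n (of_real (- a))) + - a * (1 - a) * J 0"
        unfolding sums_unique[OF J, symmetric] distrib_left using s(2) by (simp del: mult_minus_left)
      moreover have "- a * (1 - a) * J 0 = 1 / (- a - 1) + 1 / 2"
        using a by (simp add: J_def divide_simps) (simp add: algebra_simps)
      ultimately have "- a * (1 - a) * suminf J = 1 / (- a - 1) + 1 / 2 + Re (\<Sum>n. zeta_trapezoid n (of_real (- a)))"
        by simp
      then show ?thesis by (simp del: of_real_mult)
    qed
    finally show "zeta_right (of_real (- a)) = of_real (- a * (1 - a) * suminf J)" .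
  qed
qed

text \<open>In the Mellin identity the left side carries zeta at \<open>- a\<close> through
  \<open>suminf J\<close>, and the right side is a multiple of the Dirichlet series \<open>D\<close>
  of zeta at \<open>1 + a\<close>.\<close>

lemma zeta_right_functional_equation_real:
  fixes a :: real
  assumes a: "0 < a" "a < 1"
  defines "s \<equiv> complex_of_real (- a)"
  shows "zeta_right (1 - s) = 2 * of_real (2 * pi) powr (- s) * cos (of_real pi * s / 2) * Gamma s * zeta_right s"
proof -
  obtain J where J: "\<And>n. (\<integral>\<^sup>+t. ennreal (indicator {0..1} t * (t * (1 - t) / 2 * (real n + t) powr (a - 2))) \<partial>lborel) = ennreal (J n)"
    "\<And>n. J n \<ge> 0" "summable J" "zeta_right s = of_real (- a * (1 - a) * suminf J)"
    using zeta_right_neg_real_sums[OF a] unfolding s_def by blast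
  define D where "D = (\<Sum>m. real (Suc m) powr (- a - 1))"
  have sD: "summable (\<lambda>m. real (Suc m) powr (- a - 1))" using a by (intro summable_Suc_powr) simp
  have "(\<lambda>n. 1 / of_nat (Suc n) powr (1 - s)) sums zeta_right (1 - s)"
    using a by (intro zeta_right_sums) (simp add: s_def)
  also have "(\<lambda>n. 1 / of_nat (Suc n) powr (1 - s)) = (\<lambda>n. complex_of_real (real (Suc n) powr (- a - 1)))"
  proof
    fix n
    have "1 / complex_of_nat (Suc n) powr (1 - s) = of_real (real (Suc n)) powr (of_real (- a - 1))"
    proof -
      have "1 / complex_of_nat (Suc n) powr (1 - s) = of_nat (Suc n) powr (- (1 - s))"
        by (simp add: powr_minus divide_inverse del: minus_diff_eq of_nat_Suc)
      also have "- (1 - s) = of_real (- a - 1)" by (simp add: s_def)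
      finally show ?thesis by (simp only: of_real_of_nat_eq)
    qed
    then show "1 / complex_of_nat (Suc n) powr (1 - s) = of_real (real (Suc n) powr (- a - 1))"
      by (subst powr_of_real[symmetric]) auto
  qed
  finally have zD: "zeta_right (1 - s) = of_real D"
    unfolding D_def by (rule sums_unique2) (intro sums_of_real summable_sums sD)
  define C where "C = pi / cos (pi * a / 2)"
  have cos: "cos (pi * a / 2) > 0" using a by (intro cos_gt_zero) auto
  have D0: "D \<ge> 0" unfolding D_def by (intro suminf_nonneg sD) auto
  have C0: "C \<ge> 0" using cos by (simp add: C_def)
  have "ennreal (Gamma (2 - a) * suminf J) = ennreal (Gamma (2 - a)) * (\<Sum>n. ennreal (J n))"
    using a J by (subst suminf_ennreal2) (auto simp: ennreal_mult'' suminf_nonneg)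
  also have "\<dots> = (\<Sum>m. ennreal ((2 * pi * real (Suc m)) powr (- a - 1) * C))"
    using trapezoid_Mellin_identity[OF a] unfolding J(1) C_def .
  also have "(\<lambda>m. (2 * pi * real (Suc m)) powr (- a - 1) * C) = (\<lambda>m. (2 * pi) powr (- a - 1) * C * real (Suc m) powr (- a - 1))"
    by (simp add: powr_mult fun_eq_iff)
  also have "(\<Sum>m. ennreal ((2 * pi) powr (- a - 1) * C * real (Suc m) powr (- a - 1))) = ennreal ((2 * pi) powr (- a - 1) * C * D)"
    unfolding D_def using sD C0
    by (intro suminf_ennreal_eq sums_mult summable_sums) auto
  finally have eq: "Gamma (2 - a) * suminf J = (2 * pi) powr (- a - 1) * C * D"
    using a J C0 D0 Gamma_real_pos[of "2 - a"] by (subst (asm) ennreal_inj) (auto intro!: mult_nonneg_nonneg suminf_nonneg)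
  \<comment> \<open>Two steps of the Gamma recurrence give precisely the factor
    \<open>- a * (1 - a)\<close> that was pulled out of \<open>zeta_right s\<close>.\<close>
  have "Gamma (2 - a) = (1 - a) * (- a) * Gamma (- a)"
  proof -
    have "1 - a \<notin> \<int>\<^sub>\<le>\<^sub>0" "- a \<notin> \<int>\<^sub>\<le>\<^sub>0" using a nonpos_Ints_subset_Ints Ints_nonzero_abs_less1[of "1 - a"]
        Ints_nonzero_abs_less1[of "- a"] by auto
    from Gamma_plus1[OF this(1)] Gamma_plus1[OF this(2)] show ?thesis by simp
  qed
  then have "Gamma (- a) * (- a * (1 - a) * suminf J) = (2 * pi) powr (- a - 1) * C * D"
    using eq by (simp add: mult_ac)
  then have "D = 2 * (2 * pi) powr a * cos (pi * a / 2) * Gamma (- a) * (- a * (1 - a) * suminf J)"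
    using cos by (simp add: C_def powr_diff powr_minus field_simps)
  then have "complex_of_real D = of_real (2 * (2 * pi) powr a * cos (pi * a / 2) * Gamma (- a) * (- a * (1 - a) * suminf J))"
    by simp
  also have "\<dots> = 2 * of_real (2 * pi) powr (- s) * cos (of_real pi * s / 2) * Gamma s * zeta_right s"
  proof -
    have "complex_of_real (2 * pi) powr (- s) = of_real ((2 * pi) powr a)"
      unfolding s_def by (subst powr_of_real[symmetric]) auto
    moreover have "cos (of_real pi * s / 2) = complex_of_real (cos (pi * a / 2))"
      unfolding s_def by (simp flip: cos_of_real)
    moreover have "Gamma s = complex_of_real (Gamma (- a))"
      unfolding s_def by (rule Gamma_complex_of_real)
    ultimately show ?thesis unfolding J(4) by (simp only: of_real_mult of_real_numeral)
  qed
  finally show ?thesis unfolding zD .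
qed

section \<open>The functional equation\<close>

text \<open>The classical factor \<chi> in \<zeta>(1 - s) = \<chi>(s) \<zeta>(s).\<close>

definition zeta_factor :: "complex \<Rightarrow> complex" where
  "zeta_factor s = 2 * of_real (2 * pi) powr (- s) * cos (of_real pi * s / 2) * Gamma s"

lemma not_nonpos_Int_if_Re_gt:
  assumes "Re s > - 1" "s \<noteq> 0"
  shows "s \<notin> \<int>\<^sub>\<le>\<^sub>0"
proof
  assume "s \<in> \<int>\<^sub>\<le>\<^sub>0"
  then obtain n where n: "s = of_int n" "n \<le> 0" by (elim nonpos_Ints_cases)
  with assms(1) have "n = 0" by simp
  with n assms(2) show False by simp
qed

lemma holomorphic_on_zeta_factor:
  assumes "\<And>s. s \<in> A \<Longrightarrow> Re s > - 1 \<and> s \<noteq> 0"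
  shows "zeta_factor holomorphic_on A"
  unfolding zeta_factor_def using assms
  by (intro holomorphic_intros) (auto simp: not_nonpos_Int_if_Re_gt)

text \<open>Identity theorem: the strip is invariant under \<open>s \<mapsto> 1 - s\<close>, stays
  connected without 0 and 1, and contains the real segment (-1, 0), where the equation is
  known.\<close>

lemma zeta_right_functional_equation:
  assumes s: "- 1 < Re s" "Re s < 2" "s \<noteq> 0" "s \<noteq> 1"
  shows "zeta_right (1 - s) = zeta_factor s * zeta_right s"
proof -
  define S where "S = {s. - 1 < Re s \<and> Re s < 2} - {0} - {1}"
  let ?T = "{s. - 1 < Re s} \<inter> {s. Re s < 2}"
  have S_eq: "S = ?T - {0} - {1}" by (auto simp: S_def)
  have T: "open ?T" "connected ?T"
    by (auto intro!: open_Int open_halfspace_Re_gt open_halfspace_Re_lt convex_connected convex_Int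
        convex_halfspace_Re_gt convex_halfspace_Re_lt)
  have S: "open S" "connected S"
    unfolding S_eq by (intro open_delete T connected_open_delete; simp)+
  have hol: "(\<lambda>s. zeta_right (1 - s) - zeta_factor s * zeta_right s) holomorphic_on S"
  proof (intro holomorphic_intros)
    have "zeta_right \<circ> (\<lambda>s. 1 - s) holomorphic_on S"
      by (rule holomorphic_on_compose_gen[OF _ holomorphic_on_zeta_right])
         (auto intro!: holomorphic_intros simp: S_def)
    then show "(\<lambda>s. zeta_right (1 - s)) holomorphic_on S" by (simp add: o_def)
    show "zeta_factor holomorphic_on S" by (rule holomorphic_on_zeta_factor) (auto simp: S_def)
    show "zeta_right holomorphic_on S"
      by (rule holomorphic_on_subset[OF holomorphic_on_zeta_right]) (auto simp: S_def)
  qed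
  have "zeta_right (1 - s) - zeta_factor s * zeta_right s = 0"
  proof (rule analytic_continuation[OF hol S])
    let ?U = "(\<lambda>a. complex_of_real (- a)) ` {0<..<1}"
    show "?U \<subseteq> S" "of_real (- (1 / 2)) \<in> S" "s \<in> S" using s by (auto simp: S_def dest: arg_cong[of _ _ Re])
    show "complex_of_real (- (1 / 2)) islimpt ?U"
      unfolding islimpt_approachable
    proof (intro allI impI)
      fix e :: real assume e: "e > 0"
      \<comment> \<open>A point other than \<open>1 / 2\<close>, at distance at most
        \<open>e / 2\<close> from it; the cap \<open>1 / 4\<close> keeps it inside the unit
        interval.\<close>
      define b where "b = 1 / 2 + min (e / 2) (1 / 4)"
      have b: "b \<in> {0<..<1}" "b \<noteq> 1 / 2" "\<bar>b - 1 / 2\<bar> < e"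
        using e by (auto simp: b_def min_def)
      have "dist (complex_of_real (- b)) (complex_of_real (- (1 / 2))) = \<bar>b - 1 / 2\<bar>"
        unfolding dist_of_real by (simp add: dist_real_def)
      with b show "\<exists>x'\<in>?U. x' \<noteq> complex_of_real (- (1 / 2)) \<and> dist x' (complex_of_real (- (1 / 2))) < e"
        by (intro bexI[of _ "complex_of_real (- b)"]) (auto simp del: of_real_minus)
    qed
    fix z assume "z \<in> ?U"
    then show "zeta_right (1 - z) - zeta_factor z * zeta_right z = 0"
      using zeta_right_functional_equation_real unfolding zeta_factor_def by auto
  qed
  then show ?thesis by simp
qed

section \<open>Identification of \<open>riemann_zeta\<close> with the continuation\<close>

text \<open>Uniqueness in the description: two candidates agree for \<open>Re s > 1\<close>, hence
  on the connected punctured plane, and the value at the pole is prescribed.\<close>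

lemma riemann_zeta_eqI:
  assumes "F holomorphic_on - {1}" "F 1 = 0"
    and "\<And>s. Re s > 1 \<Longrightarrow> (\<lambda>n. 1 / of_nat (Suc n) powr s) sums F s"
  shows "riemann_zeta = F"
  unfolding riemann_zeta_def
proof (rule the_equality)
  show "F holomorphic_on - {1} \<and> F 1 = 0 \<and> (\<forall>s. Re s > 1 \<longrightarrow> (\<lambda>n. 1 / of_nat (Suc n) powr s) sums F s)"
    using assms by blast
  fix G assume G: "G holomorphic_on - {1} \<and> G 1 = 0 \<and> (\<forall>s. Re s > 1 \<longrightarrow> (\<lambda>n. 1 / of_nat (Suc n) powr s) sums G s)"
  show "G = F"
  proof
    fix s
    show "G s = F s"
    proof (cases "s = 1")
      case False
      show ?thesis
      proof (rule analytic_continuation_open[of "{s. Re s > 1}" "- {1}" G F])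
        show "{s. Re s > 1} \<noteq> {}" by (auto intro!: exI[of _ 2])
        show "connected (- {1::complex})"
          unfolding Compl_eq_Diff_UNIV
          by (intro connected_open_delete convex_connected[OF convex_UNIV]) auto
        show "G z = F z" if "z \<in> {s. Re s > 1}" for z
          using G assms(3) that sums_unique2 by blast
      qed (use G assms False in \<open>auto simp: open_halfspace_Re_gt\<close>)
    qed (use G assms in auto)
  qed
qed

text \<open>The functional equation extends \<open>zeta_right\<close> to \<open>Re s < 0\<close>.
  The two pieces agree on the overlap, so they glue to a function \<open>G\<close> that satisfies
  the description of \<open>riemann_zeta\<close>.\<close>

lemma riemann_zeta_eq_zeta_right:
  assumes "Re s > - 1" "s \<noteq> 1"
  shows "riemann_zeta s = zeta_right s"
proof -
  let ?A = "{s. Re s > - 1} - {1::complex}" and ?B = "{s::complex. Re s < 0}"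
  define F where "F = (\<lambda>s. if s \<in> ?A then zeta_right s else zeta_factor (1 - s) * zeta_right (1 - s))"
  \<comment> \<open>At 1 the function \<open>F\<close> takes its second branch; the description
    demands 0 there.\<close>
  define G where "G = F(1 := 0)"
  have "F holomorphic_on (?A \<union> ?B)"
    unfolding F_def
  proof (rule holomorphic_on_If_Un)
    have "(\<lambda>s. zeta_factor s * zeta_right s) \<circ> (\<lambda>s. 1 - s) holomorphic_on ?B"
    proof (rule holomorphic_on_compose_gen)
      show "(\<lambda>s. zeta_factor s * zeta_right s) holomorphic_on {s. Re s > 1}"
        by (intro holomorphic_intros holomorphic_on_zeta_factor holomorphic_on_subset[OF holomorphic_on_zeta_right])
           auto
    qed (auto intro!: holomorphic_intros)
    then show "(\<lambda>s. zeta_factor (1 - s) * zeta_right (1 - s)) holomorphic_on ?B"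
      by (simp add: o_def)
    fix z assume "z \<in> ?A" "z \<in> ?B"
    then have "Re z < 0" "Re z > - 1" "z \<noteq> 0" "z \<noteq> 1" by auto
    then show "zeta_right z = zeta_factor (1 - z) * zeta_right (1 - z)"
      using zeta_right_functional_equation[of "1 - z"] by auto
  qed (auto intro!: holomorphic_on_zeta_right open_delete open_halfspace_Re_gt open_halfspace_Re_lt)
  also have "?A \<union> ?B = - {1}" by auto
  finally have hol: "G holomorphic_on - {1}"
    by (rule holomorphic_transform) (auto simp: G_def)
  have "riemann_zeta = G"
  proof (rule riemann_zeta_eqI[OF hol])
    show "(\<lambda>n. 1 / of_nat (Suc n) powr z) sums G z" if "Re z > 1" for z
    proof -
      have "G z = zeta_right z" using that by (auto simp: G_def F_def)
      then show ?thesis using zeta_right_sums[OF that] by simp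
    qed
  qed (simp add: G_def)
  then have "riemann_zeta s = G s" by simp
  then show ?thesis using assms by (simp add: G_def F_def)
qed

lemma holomorphic_on_riemann_zeta:
  assumes "A \<subseteq> {s. Re s > - 1} - {1}"
  shows "riemann_zeta holomorphic_on A"
  by (rule holomorphic_transform[OF holomorphic_on_subset[OF holomorphic_on_zeta_right assms]])
     (use assms in \<open>auto intro!: riemann_zeta_eq_zeta_right[symmetric]\<close>)

lemma riemann_zeta_functional_equation_strip:
  assumes "- 1 < Re s" "Re s < 2" "s \<noteq> 0" "s \<noteq> 1"
  shows "riemann_zeta (1 - s) = zeta_factor s * riemann_zeta s"
  using zeta_right_functional_equation[OF assms] assms
  by (simp add: riemann_zeta_eq_zeta_right)

section \<open>Conjugation symmetry and derivatives of zeta\<close>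

lemma cnj_zeta_trapezoid: "cnj (zeta_trapezoid n s) = zeta_trapezoid n (cnj s)"
  by (simp add: zeta_trapezoid_def cnj_powr del: of_nat_Suc)

lemma cnj_riemann_zeta:
  assumes "Re s > - 1" "s \<noteq> 1"
  shows "cnj (riemann_zeta s) = riemann_zeta (cnj s)"
proof -
  have "(\<lambda>n. cnj (zeta_trapezoid n s)) sums cnj (\<Sum>n. zeta_trapezoid n s)"
    using assms by (subst sums_cnj) (intro summable_sums summable_zeta_trapezoid)
  then have "cnj (zeta_right s) = zeta_right (cnj s)"
    unfolding zeta_right_def cnj_zeta_trapezoid by (simp add: sums_iff)
  moreover have "cnj s \<noteq> 1" using assms by (metis complex_cnj_cnj complex_cnj_one)
  ultimately show ?thesis
    using assms by (simp add: riemann_zeta_eq_zeta_right)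
qed

lemma riemann_zeta_has_field_derivative:
  assumes "Re s > - 1" "s \<noteq> 1"
  shows "(riemann_zeta has_field_derivative deriv riemann_zeta s) (at s)"
proof (rule holomorphic_derivI)
  show "riemann_zeta holomorphic_on {s. Re s > - 1} - {1}"
    by (rule holomorphic_on_riemann_zeta) simp
qed (use assms in \<open>auto intro!: open_delete open_halfspace_Re_gt\<close>)

text \<open>Near \<open>cnj s\<close> the function
  \<open>cnj \<circ> riemann_zeta \<circ> cnj\<close> coincides with \<open>riemann_zeta\<close>, so
  their derivatives there agree.\<close>

lemma cnj_deriv_riemann_zeta:
  assumes "Re s > - 1" "s \<noteq> 1"
  shows "cnj (deriv riemann_zeta s) = deriv riemann_zeta (cnj s)"
proof -
  have s': "Re (cnj s) > - 1" "cnj s \<noteq> 1"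
    using assms by (auto simp: complex_eq_iff)
  have "((cnj \<circ> riemann_zeta \<circ> cnj) has_field_derivative cnj (deriv riemann_zeta s)) (at (cnj s))"
    by (rule has_field_derivative_cnj_cnj) (simp add: riemann_zeta_has_field_derivative assms)
  moreover have "\<forall>\<^sub>F z in nhds (cnj s). (cnj \<circ> riemann_zeta \<circ> cnj) z = riemann_zeta z"
  proof -
    have "\<forall>\<^sub>F z in nhds (cnj s). z \<in> {s. Re s > - 1} - {1}"
      using s' by (intro eventually_nhds_in_open open_delete open_halfspace_Re_gt) auto
    then show ?thesis
      by eventually_elim (use cnj_riemann_zeta in auto)
  qed
  ultimately have "(riemann_zeta has_field_derivative cnj (deriv riemann_zeta s)) (at (cnj s))"
    by (subst (asm) DERIV_cong_ev[OF refl _ refl]) auto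
  then show ?thesis
    using DERIV_unique riemann_zeta_has_field_derivative[OF s'] by blast
qed

section \<open>The critical line\<close>

lemma cnj_Digamma:
  fixes z :: complex
  assumes "z \<noteq> 0"
  shows "cnj (Digamma z) = Digamma (cnj z)"
proof -
  have "(\<lambda>k. cnj (inverse (of_nat (Suc k)) - inverse (z + of_nat k))) sums
      cnj (\<Sum>k. inverse (of_nat (Suc k)) - inverse (z + of_nat k))"
    by (subst sums_cnj) (intro summable_sums summable_Digamma assms)
  moreover have "cnj (euler_mascheroni :: complex) = euler_mascheroni"
    by (metis complex_cnj_complex_of_real of_real_euler_mascheroni)
  ultimately show ?thesis
    unfolding Digamma_def by (simp add: sums_iff)
qed

lemma zeta_factor_has_field_derivative:
  assumes "s \<notin> \<int>\<^sub>\<le>\<^sub>0" "cos (of_real pi * s / 2) \<noteq> 0"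
  shows "(zeta_factor has_field_derivative
           zeta_factor s * (Digamma s - of_real (ln (2 * pi)) - of_real (pi / 2) * tan (of_real pi * s / 2))) (at s)"
proof -
  have "complex_of_real (2 * pi) powr (- s) = exp (- (s * of_real (ln (2 * pi))))" for s
    by (subst powr_def, subst Ln_of_real) auto
  then have eq: "zeta_factor = (\<lambda>s. 2 * exp (- (s * of_real (ln (2 * pi)))) * cos (of_real pi * s / 2) * Gamma s)"
    by (simp add: zeta_factor_def fun_eq_iff del: of_real_mult)
  show ?thesis
    unfolding eq using assms
    by (auto intro!: derivative_eq_intros simp: tan_def field_simps)
qed

lemma cos_of_real_plus_imaginary:
  fixes x y :: real
  shows "cos (of_real x + \<i> * of_real y) = Complex (cos x * cosh y) (- sin x * sinh y)"
  unfolding cos_add cosh_real[symmetric] sin_i_times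
  by (simp add: complex_eq_iff cosh_field_def sinh_field_def exp_minus cos_of_real sin_of_real exp_of_real
      flip: of_real_inverse)

lemma sin_of_real_plus_imaginary:
  fixes x y :: real
  shows "sin (of_real x + \<i> * of_real y) = Complex (sin x * cosh y) (cos x * sinh y)"
  unfolding sin_add cosh_real[symmetric] sin_i_times
  by (simp add: complex_eq_iff cosh_field_def sinh_field_def exp_minus cos_of_real sin_of_real exp_of_real
      flip: of_real_inverse)

text \<open>Here \<open>1 - s\<close> is \<open>cnj s\<close>, so the reflection formula gives the
  difference of \<open>cnj (Digamma s)\<close> and \<open>Digamma s\<close>, which is purely
  imaginary; the cotangent at \<open>pi * s\<close> equals
  \<open>- \<i> * tanh (pi * \<rho>)\<close>.\<close>

lemma Digamma_critical_line_Im: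
  fixes \<rho> :: real
  shows "Im (Digamma (1 / 2 + \<i> * of_real \<rho>)) = pi / 2 * sinh (pi * \<rho>) / cosh (pi * \<rho>)"
proof -
  let ?s = "1 / 2 + \<i> * complex_of_real \<rho>"
  have s: "?s \<notin> \<int>"
  proof
    assume "?s \<in> \<int>"
    then obtain n where "?s = of_int n" by (auto elim: Ints_cases)
    then have "real_of_int (2 * n) = of_int 1" by (simp add: complex_eq_iff)
    then have "2 * n = 1" by (simp only: of_int_eq_iff)
    then show False by presburger
  qed
  have "1 - ?s = cnj ?s" by (simp add: complex_eq_iff)
  then have "cnj (Digamma ?s) - Digamma ?s = of_real pi * cot (of_real pi * ?s)"
    using Digamma_reflection_complex[OF s] s by (subst cnj_Digamma) auto
  also have "of_real pi * ?s = of_real (pi / 2) + \<i> * of_real (pi * \<rho>)"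
    by (simp add: algebra_simps)
  also have "cot \<dots> = - (\<i> * of_real (sinh (pi * \<rho>) / cosh (pi * \<rho>)))"
    unfolding cot_def cos_of_real_plus_imaginary sin_of_real_plus_imaginary
    by (simp add: complex_eq_iff Re_divide Im_divide power2_eq_square)
  finally show ?thesis by (auto simp: complex_eq_iff)
qed

text \<open>The squared modulus is \<open>Gamma s * Gamma (1 - s)\<close>, which the reflection
  formula evaluates.\<close>

lemma norm_Gamma_critical_line:
  fixes \<rho> :: real
  shows "cmod (Gamma (1 / 2 + \<i> * of_real \<rho>)) = sqrt (pi / cosh (pi * \<rho>))"
proof -
  let ?s = "1 / 2 + \<i> * complex_of_real \<rho>"
  have "complex_of_real ((cmod (Gamma ?s))\<^sup>2) = Gamma ?s * Gamma (1 - ?s)"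
    unfolding complex_norm_square cnj_Gamma by simp
  also have "\<dots> = of_real pi / sin (of_real (pi / 2) + \<i> * of_real (pi * \<rho>))"
    unfolding Gamma_reflection_complex by (simp add: algebra_simps)
  also have "\<dots> = of_real (pi / cosh (pi * \<rho>))"
    unfolding sin_of_real_plus_imaginary by (simp add: complex_eq_iff Re_divide Im_divide power2_eq_square)
  finally have "(cmod (Gamma ?s))\<^sup>2 = pi / cosh (pi * \<rho>)" by (simp only: of_real_eq_iff)
  then show ?thesis by (metis norm_ge_zero real_sqrt_unique)
qed

text \<open>Polar decomposition of each factor: the power of \<open>2 * pi\<close> and
  \<open>Gamma\<close> contribute the phases \<open>- \<rho> * ln (2 * pi)\<close> and
  \<open>\<theta>\<close>, and the cosine is taken at
  \<open>pi / 4 + \<i> * pi * \<rho> / 2\<close>. All constants cancel except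
  \<open>1 / sqrt (cosh (pi * \<rho>))\<close>.\<close>

lemma zeta_factor_critical_line:
  fixes \<rho> \<theta> :: real
  assumes "is_Arg (Gamma (1 / 2 + \<i> * of_real \<rho>)) \<theta>"
  shows "zeta_factor (1 / 2 + \<i> * of_real \<rho>) =
     cis (\<theta> - \<rho> * ln (2 * pi)) * Complex (cosh (pi * \<rho> / 2)) (- sinh (pi * \<rho> / 2)) / of_real (sqrt (cosh (pi * \<rho>)))"
proof -
  let ?s = "1 / 2 + \<i> * complex_of_real \<rho>"
  define L where "L = ln (2 * pi)"
  have "complex_of_real (2 * pi) powr (- ?s) = exp (- ?s * of_real L)"
    unfolding L_def by (subst powr_def, subst Ln_of_real) auto
  also have "- ?s * of_real L = of_real (- (L / 2)) + \<i> * of_real (- \<rho> * L)"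
    by (simp add: algebra_simps)
  also have "exp \<dots> = of_real (exp (- (L / 2))) * cis (- \<rho> * L)"
    unfolding exp_add exp_of_real cis_conv_exp ..
  also have "exp (- (L / 2)) = 1 / sqrt (2 * pi)"
  proof -
    have "exp (L / 2) ^ 2 = 2 * pi" using exp_double[of "L / 2"] by (simp add: L_def)
    then have "sqrt (2 * pi) = exp (L / 2)" by (rule real_sqrt_unique) simp
    then show ?thesis unfolding exp_minus by (simp only: inverse_eq_divide)
  qed
  finally have 1: "complex_of_real (2 * pi) powr (- ?s) = of_real (1 / sqrt (2 * pi)) * cis (- \<rho> * L)" .
  have "of_real pi * ?s / 2 = of_real (pi / 4) + \<i> * of_real (pi * \<rho> / 2)"
    by (simp add: field_simps)
  then have 2: "cos (of_real pi * ?s / 2) = of_real (sqrt 2 / 2) * Complex (cosh (pi * \<rho> / 2)) (- sinh (pi * \<rho> / 2))"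
    by (simp only: cos_of_real_plus_imaginary cos_45 sin_45) (simp add: complex_eq_iff)
  have 3: "Gamma ?s = of_real (sqrt (pi / cosh (pi * \<rho>))) * cis \<theta>"
    using assms unfolding is_Arg_def norm_Gamma_critical_line cis_conv_exp .
  have "zeta_factor ?s = of_real (2 * (1 / sqrt (2 * pi)) * (sqrt 2 / 2) * sqrt (pi / cosh (pi * \<rho>))) *
     (cis \<theta> * cis (- \<rho> * L)) * Complex (cosh (pi * \<rho> / 2)) (- sinh (pi * \<rho> / 2))"
    unfolding zeta_factor_def 1 2 3 by (simp add: mult_ac)
  also have "2 * (1 / sqrt (2 * pi)) * (sqrt 2 / 2) * sqrt (pi / cosh (pi * \<rho>)) = 1 / sqrt (cosh (pi * \<rho>))"
    by (simp add: real_sqrt_mult real_sqrt_divide)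
  also have "cis \<theta> * cis (- \<rho> * L) = cis (\<theta> - \<rho> * ln (2 * pi))"
    by (simp add: cis_mult L_def)
  finally show ?thesis by simp
qed

text \<open>The logarithmic derivative of \<chi> is real on the critical line, because the imaginary
  part of \<open>Digamma s\<close> cancels that of \<open>pi / 2\<close> times the tangent. What
  remains is \<open>- 2 / f_fun \<rho>\<close>, written so that \<open>f_denom\<close> stays in the
  numerator.\<close>

lemma zeta_factor_deriv_critical_line:
  fixes \<rho> :: real
  defines "s \<equiv> 1 / 2 + \<i> * complex_of_real \<rho>"
  shows "(zeta_factor has_field_derivative
           - zeta_factor s * of_real (f_denom \<rho> / (2 * cosh (pi * \<rho>)))) (at s)"
proof -
  define y where "y = pi * \<rho> / 2"
  define c h where "c = cosh y" and "h = sinh y"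
  have C: "cosh (pi * \<rho>) = c\<^sup>2 + h\<^sup>2" "sinh (pi * \<rho>) = 2 * h * c"
    using cosh_double[of y] sinh_double[of y] by (simp_all add: c_def h_def y_def)
  have ch: "c\<^sup>2 - h\<^sup>2 = 1" using cosh_square_eq[of y] by (simp add: c_def h_def)
  have c0: "c > 0" by (simp add: c_def)
  then have D0: "c\<^sup>2 + h\<^sup>2 > 0" by (simp add: add_pos_nonneg)
  define T where "T = 1 / (c\<^sup>2 + h\<^sup>2)"
  have arg: "of_real pi * s / 2 = of_real (pi / 4) + \<i> * of_real y"
    by (simp add: s_def y_def field_simps)
  have cos: "cos (of_real pi * s / 2) = of_real (sqrt 2 / 2) * Complex c (- h)"
    unfolding arg cos_of_real_plus_imaginary cos_45 sin_45 by (simp add: complex_eq_iff c_def h_def)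
  have sin: "sin (of_real pi * s / 2) = of_real (sqrt 2 / 2) * Complex c h"
    unfolding arg sin_of_real_plus_imaginary cos_45 sin_45 by (simp add: complex_eq_iff c_def h_def)
  have "tan (of_real pi * s / 2) = Complex c h / Complex c (- h)"
    unfolding tan_def cos sin by simp
  \<comment> \<open>Multiplying by the conjugate gives the square of \<open>Complex c h\<close> over
    \<open>c\<^sup>2 + h\<^sup>2\<close>; its real part simplifies by
    \<open>c\<^sup>2 - h\<^sup>2 = 1\<close>.\<close>
  also have "\<dots> = Complex T (2 * h * c * T)"
    using ch by (simp add: T_def complex_eq_iff Re_divide Im_divide power2_eq_square)
  finally have tan: "tan (of_real pi * s / 2) = Complex T (2 * h * c * T)" .
  have nz: "cos (of_real pi * s / 2) \<noteq> 0" unfolding cos using c0 by (simp add: complex_eq_iff)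
  have "s \<notin> \<int>\<^sub>\<le>\<^sub>0" by (rule not_nonpos_Int_if_Re_gt) (auto simp: s_def complex_eq_iff)
  note d = zeta_factor_has_field_derivative[OF this nz]
  have "Im (Digamma s) = pi / 2 * (2 * h * c * T)"
    using Digamma_critical_line_Im[of \<rho>] unfolding C s_def T_def by simp
  moreover have "f_denom \<rho> / (2 * cosh (pi * \<rho>)) = ln (2 * pi) - Re (Digamma s) + pi / 2 * T"
  proof -
    have "D \<noteq> 0 \<Longrightarrow> (2 * l * D - 2 * r * D + pi) / (2 * D) = l - r + pi / 2 * (1 / D)" for D l r
      by (simp add: field_simps)
    from this[of "c\<^sup>2 + h\<^sup>2"] show ?thesis
      unfolding f_denom_def C s_def[symmetric] T_def using less_imp_neq[OF D0] by metis
  qed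
  ultimately have "Digamma s - of_real (ln (2 * pi)) - of_real (pi / 2) * tan (of_real pi * s / 2)
     = - of_real (f_denom \<rho> / (2 * cosh (pi * \<rho>)))"
    unfolding tan by (simp add: complex_eq_iff)
  then show ?thesis using d by simp
qed

section \<open>The zero of the denominator of f\<close>

text \<open>The series is compared term by term: the real part of
  \<open>inverse (1 / 2 + \<i> * t + k)\<close> decreases as \<open>t \<ge> 0\<close> grows, and it
  enters with a minus sign.\<close>

lemma Re_Digamma_critical_line_mono:
  fixes x y :: real
  assumes "0 \<le> x" "x \<le> y"
  shows "Re (Digamma (1 / 2 + \<i> * of_real x)) \<le> Re (Digamma (1 / 2 + \<i> * of_real y))"
proof -
  have sums: "(\<lambda>k. Re (inverse (of_nat (Suc k)) - inverse (1 / 2 + \<i> * complex_of_real t + of_nat k))) sums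
      (Re (Digamma (1 / 2 + \<i> * of_real t)) + Re euler_mascheroni)" for t
  proof -
    have "(\<lambda>k. inverse (of_nat (Suc k)) - inverse (1 / 2 + \<i> * complex_of_real t + of_nat k)) sums
      (Digamma (1 / 2 + \<i> * of_real t) + euler_mascheroni)"
      unfolding Digamma_def by (simp only: diff_add_cancel)
        (intro summable_sums summable_Digamma, simp add: complex_eq_iff)
    from sums_Re[OF this] show ?thesis by simp
  qed
  have "Re (Digamma (1 / 2 + \<i> * of_real x)) + Re euler_mascheroni \<le> Re (Digamma (1 / 2 + \<i> * of_real y)) + Re euler_mascheroni"
  proof (rule sums_le[OF _ sums sums])
    fix k
    have "Re (inverse (1 / 2 + \<i> * complex_of_real t + of_nat k)) = (1 / 2 + real k) / ((1 / 2 + real k)\<^sup>2 + t\<^sup>2)" for t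
      by (simp add: Re_divide inverse_eq_divide power2_eq_square)
    moreover have "(1 / 2 + real k) / ((1 / 2 + real k)\<^sup>2 + y\<^sup>2) \<le> (1 / 2 + real k) / ((1 / 2 + real k)\<^sup>2 + x\<^sup>2)"
      using assms by (intro divide_left_mono add_left_mono power_mono) (auto intro!: mult_pos_pos add_pos_nonneg)
    ultimately show "Re (inverse (of_nat (Suc k)) - inverse (1 / 2 + \<i> * complex_of_real x + of_nat k))
       \<le> Re (inverse (of_nat (Suc k)) - inverse (1 / 2 + \<i> * complex_of_real y + of_nat k))"
      by (simp del: of_nat_Suc)
  qed
  then show ?thesis by simp
qed

lemma f_denom_div_cosh:
  "f_denom \<rho> / cosh (pi * \<rho>) = 2 * ln (2 * pi) - 2 * Re (Digamma (1 / 2 + \<i> * of_real \<rho>)) + pi / cosh (pi * \<rho>)"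
  using cosh_real_pos[of "pi * \<rho>"] by (simp add: f_denom_def field_simps)

text \<open>The \<open>Digamma\<close> part contributes weak monotonicity; strictness comes from
  \<open>pi / cosh\<close>.\<close>

lemma f_denom_div_cosh_strict_antimono:
  fixes x y :: real
  assumes "0 \<le> x" "x < y"
  shows "f_denom y / cosh (pi * y) < f_denom x / cosh (pi * x)"
proof -
  have "cosh (pi * x) < cosh (pi * y)"
    using assms by (simp add: cosh_real_nonneg_less_iff)
  then have "pi / cosh (pi * y) < pi / cosh (pi * x)"
    by (intro divide_strict_left_mono mult_pos_pos) auto
  then show ?thesis
    unfolding f_denom_div_cosh using Re_Digamma_critical_line_mono[of x y] assms by simp
qed

text \<open>A nonnegative zero is positive, since \<open>f_denom 0 > 0\<close>, and is the only
  positive one by strict monotonicity. Such a zero is therefore the number that the description of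
  \<open>rho_s\<close> selects.\<close>

lemma f_denom_nonzero:
  fixes \<rho> :: real
  assumes "\<rho> \<ge> 0" "\<rho> \<noteq> rho_s"
  shows "f_denom \<rho> \<noteq> 0"
proof
  assume zero: "f_denom \<rho> = 0"
  have "Re (Digamma (1 / 2 :: complex)) < 0"
  proof -
    have "(Digamma (1 / 2) :: complex) = of_real (- euler_mascheroni - 2 * ln 2)"
      by (simp add: Digamma_one_half)
    moreover have "- euler_mascheroni - 2 * ln 2 < (0::real)"
      using euler_mascheroni_pos ln_gt_zero[of "2::real"] by linarith
    ultimately show ?thesis by (simp only: Re_complex_of_real)
  qed
  moreover have "ln (2 * pi) > 0" using pi_gt3 by (intro ln_gt_zero) simp
  ultimately have "2 * ln (2 * pi) - 2 * Re (Digamma (1 / 2 :: complex)) + pi > 0"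
    using pi_gt_zero by linarith
  then have "f_denom 0 > 0" by (simp add: f_denom_def)
  with zero assms have pos: "\<rho> > 0" by (cases "\<rho> = 0") auto
  have unique: "r = \<rho>" if "r > 0 \<and> f_denom r = 0" for r
  proof -
    have "f_denom r / cosh (pi * r) = 0" "f_denom \<rho> / cosh (pi * \<rho>) = 0"
      using that zero by simp_all
    then have "\<not> r < \<rho>" "\<not> \<rho> < r"
      using f_denom_div_cosh_strict_antimono[of r \<rho>] f_denom_div_cosh_strict_antimono[of \<rho> r]
        that pos by linarith+
    then show ?thesis by simp
  qed
  have "rho_s = \<rho>"
    unfolding rho_s_def by (rule the_equality[OF _ unique]) (use zero pos in auto)
  with assms show False by simp
qed

section \<open>The differentiated functional equation and its squared modulus\<close>

text \<open>Both sides of the functional equation are differentiated at \<open>s\<close>; since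
  \<open>1 - s\<close> is \<open>cnj s\<close>, the left derivative is the negated conjugate of the
  derivative of zeta at \<open>s\<close>.\<close>

lemma riemann_zeta_deriv_critical_line:
  fixes \<rho> :: real
  defines "s \<equiv> 1 / 2 + \<i> * complex_of_real \<rho>"
  shows "zeta_factor s * of_real (f_denom \<rho> / (2 * cosh (pi * \<rho>))) * riemann_zeta s =
           cnj (deriv riemann_zeta s) + zeta_factor s * deriv riemann_zeta s"
proof -
  let ?d = "complex_of_real (f_denom \<rho> / (2 * cosh (pi * \<rho>)))"
  have s: "Re s > - 1" "Re s < 2" "s \<noteq> 0" "s \<noteq> 1"
    by (auto simp: s_def complex_eq_iff)
  have cs: "1 - s = cnj s" by (simp add: s_def complex_eq_iff)
  have s': "Re (cnj s) > - 1" "cnj s \<noteq> 1" using s by (auto simp: s_def complex_eq_iff)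
  have lhs: "((\<lambda>w. riemann_zeta (1 - w)) has_field_derivative deriv riemann_zeta (1 - s) * (0 - 1)) (at s)"
  proof (rule DERIV_chain2[where f = riemann_zeta])
    show "(riemann_zeta has_field_derivative deriv riemann_zeta (1 - s)) (at (1 - s))"
      unfolding cs by (rule riemann_zeta_has_field_derivative[OF s'])
    show "((\<lambda>w. 1 - w) has_field_derivative 0 - 1) (at s)" by (intro derivative_intros)
  qed
  have rhs: "((\<lambda>w. zeta_factor w * riemann_zeta w) has_field_derivative
      - zeta_factor s * ?d * riemann_zeta s + deriv riemann_zeta s * zeta_factor s) (at s)"
    unfolding s_def
    by (intro DERIV_mult zeta_factor_deriv_critical_line riemann_zeta_has_field_derivative)
       (use s in \<open>auto simp: s_def\<close>)
  have "\<forall>\<^sub>F w in nhds s. riemann_zeta (1 - w) = zeta_factor w * riemann_zeta w"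
  proof -
    have "open ({w. Re w > - 1} \<inter> {w. Re w < 2} - {0} - {1::complex})"
      by (intro open_delete open_Int open_halfspace_Re_gt open_halfspace_Re_lt)
    then have "\<forall>\<^sub>F w in nhds s. w \<in> {w. Re w > - 1} \<inter> {w. Re w < 2} - {0} - {1}"
      using s by (intro eventually_nhds_in_open) auto
    then show ?thesis
      by eventually_elim (auto intro!: riemann_zeta_functional_equation_strip)
  qed
  then have "deriv riemann_zeta (1 - s) * (0 - 1) =
      - zeta_factor s * ?d * riemann_zeta s + deriv riemann_zeta s * zeta_factor s"
    by (intro DERIV_unique[OF _ rhs] DERIV_cong_ev[OF refl _ refl, THEN iffD1, OF _ lhs])
  moreover have "deriv riemann_zeta (1 - s) = cnj (deriv riemann_zeta s)"
    unfolding cs using s by (simp add: cnj_deriv_riemann_zeta)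
  ultimately show ?thesis by (simp add: algebra_simps)
qed

text \<open>Both summands have modulus \<open>cmod z\<close>, and the cross term pairs
  \<open>X * z\<close> with the conjugate of \<open>cnj z\<close>, which is
  \<open>z\<close>.\<close>

lemma cmod_cnj_add_unimodular_mult:
  assumes "cmod X = 1"
  shows "(cmod (cnj z + X * z))\<^sup>2 = 2 * (cmod z)\<^sup>2 + 2 * Re (X * z\<^sup>2)"
proof -
  have "(Re X)\<^sup>2 + (Im X)\<^sup>2 = 1" using assms cmod_power2[of X] by simp
  then show ?thesis
    unfolding cmod_power2 by (simp add: power2_eq_square) algebra
qed

theorem mainTheorem7:
  fixes \<rho> \<beta> \<theta> \<rho>\<^sub>\<theta> :: real
  assumes "\<rho> \<ge> 0" and "\<rho> \<noteq> rho_s"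
    and "deriv riemann_zeta (1 / 2 + \<i> * of_real \<rho>) \<noteq> 0"
    and "is_Arg (deriv riemann_zeta (1 / 2 + \<i> * of_real \<rho>)) \<beta>"
    and "is_Arg (Gamma (1 / 2 + \<i> * of_real \<rho>)) \<theta>"
    and "\<rho>\<^sub>\<theta> = \<theta> - \<rho> * ln (2 * pi)"
  shows "4 * (cmod (riemann_zeta (1 / 2 + \<i> * of_real \<rho>)))\<^sup>2
           / ((f_fun \<rho>)\<^sup>2 * (cmod (deriv riemann_zeta (1 / 2 + \<i> * of_real \<rho>)))\<^sup>2)
         = 2 + 2 * (sinh (pi * \<rho> / 2) * sin (2 * \<beta> + \<rho>\<^sub>\<theta>)
                    + cosh (pi * \<rho> / 2) * cos (2 * \<beta> + \<rho>\<^sub>\<theta>)) / sqrt (cosh (pi * \<rho>))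
       \<and> (riemann_zeta (1 / 2 + \<i> * of_real \<rho>) = 0 \<longrightarrow>
           (sinh (pi * \<rho> / 2) * sin (2 * \<beta> + \<rho>\<^sub>\<theta>)
             + cosh (pi * \<rho> / 2) * cos (2 * \<beta> + \<rho>\<^sub>\<theta>)) / sqrt (cosh (pi * \<rho>)) = - 1)"
    (is "?L = 2 + 2 * ?N / ?r \<and> _")
proof -
  define s where "s = 1 / 2 + \<i> * complex_of_real \<rho>"
  define X where "X = zeta_factor s"
  define Z Z' where "Z = riemann_zeta s" and "Z' = deriv riemann_zeta s"
  \<comment> \<open>This is \<open>2 / f_fun \<rho>\<close>.\<close>
  define d where "d = f_denom \<rho> / (2 * cosh (pi * \<rho>))"
  define c h where "c = cosh (pi * \<rho> / 2)" and "h = sinh (pi * \<rho> / 2)"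
  have X: "X = cis \<rho>\<^sub>\<theta> * Complex c (- h) / of_real ?r"
    unfolding X_def s_def assms(6) c_def h_def by (rule zeta_factor_critical_line[OF assms(5)])
  have "c\<^sup>2 + h\<^sup>2 = cosh (pi * \<rho>)"
    using cosh_double[of "pi * \<rho> / 2"] by (simp add: c_def h_def)
  \<comment> \<open>The denominator in \<open>X\<close> normalises its modulus to 1.\<close>
  then have "cmod (Complex c (- h)) = ?r" by (simp add: cmod_def)
  then have X1: "cmod X = 1" by (simp add: X norm_mult norm_divide)
  have "X * of_real d * Z = cnj Z' + X * Z'"
    unfolding X_def d_def Z_def Z'_def s_def by (rule riemann_zeta_deriv_critical_line)
  then have "(cmod (X * of_real d * Z))\<^sup>2 = 2 * (cmod Z')\<^sup>2 + 2 * Re (X * Z'\<^sup>2)"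
    by (simp only: cmod_cnj_add_unimodular_mult[OF X1])
  then have main: "d\<^sup>2 * (cmod Z)\<^sup>2 = 2 * (cmod Z')\<^sup>2 + 2 * Re (X * Z'\<^sup>2)"
    by (simp add: norm_mult X1 power_mult_distrib)
  have "Z' = of_real (cmod Z') * cis \<beta>"
    using assms(4) unfolding is_Arg_def Z'_def s_def cis_conv_exp .
  then have "X * Z'\<^sup>2 = X * (of_real (cmod Z') * cis \<beta>)\<^sup>2" by (rule arg_cong)
  also have "\<dots> = of_real ((cmod Z')\<^sup>2) * (cis (2 * \<beta> + \<rho>\<^sub>\<theta>) * Complex c (- h) / of_real ?r)"
    unfolding X by (simp add: power_mult_distrib Complex.DeMoivre cis_mult[symmetric] mult_ac)
  \<comment> \<open>The real part of \<open>cis \<phi> * Complex c (- h)\<close> is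
    \<open>c * cos \<phi> + h * sin \<phi>\<close>, here with \<phi> =
    \<open>2 * \<beta> + \<rho>\<^sub>\<theta>\<close>.\<close>
  finally have "Re (X * Z'\<^sup>2) = (cmod Z')\<^sup>2 * (?N / ?r)"
    by (simp add: Re_complex_of_real c_def h_def add_divide_distrib distrib_left mult_ac)
  moreover have "2 * a + 2 * (a * (n / r)) = a * (2 + 2 * n / r)" for a n r :: real
    by (simp add: distrib_left)
  ultimately have key: "d\<^sup>2 * (cmod Z)\<^sup>2 = (cmod Z')\<^sup>2 * (2 + 2 * ?N / ?r)"
    using main by (simp only:)
  have Z': "(cmod Z')\<^sup>2 \<noteq> 0" using assms(3) by (simp add: Z'_def s_def)
  have d0: "d \<noteq> 0" using f_denom_nonzero[OF assms(1,2)] by (simp add: d_def)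
  have "f_fun \<rho> = 2 / d" by (simp add: f_fun_def d_def)
  then have "4 * (cmod Z)\<^sup>2 / ((f_fun \<rho>)\<^sup>2 * (cmod Z')\<^sup>2) = d\<^sup>2 * (cmod Z)\<^sup>2 / (cmod Z')\<^sup>2"
    using d0 by (simp add: power_divide)
  also have "\<dots> = 2 + 2 * ?N / ?r" unfolding key using Z' by simp
  finally have 1: "4 * (cmod Z)\<^sup>2 / ((f_fun \<rho>)\<^sup>2 * (cmod Z')\<^sup>2) = 2 + 2 * ?N / ?r" .
  moreover have "?N / ?r = - 1" if "Z = 0"
  proof -
    have "2 + 2 * n / r = 0 \<Longrightarrow> n / r = - 1" for n r :: real
      unfolding times_divide_eq_right[symmetric] by linarith
    moreover have "2 + 2 * ?N / ?r = 0" using 1 that by (metis div_0 mult_zero_right norm_zero zero_power2)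
    ultimately show ?thesis by blast
  qed
  ultimately show ?thesis unfolding Z_def Z'_def s_def by blast
qed

end
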